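(* Let $T\ge2$, $\lambda>0$, $B\ge\|\theta^*\|$, and assume $|\langle\phi(x,a),\theta^*\rangle|\le1$ for all $x\in\mathcal X$ and $a\in\bigcup_t\mathcal A_t$. Run the K-UCB rule with $\delta=1/T^2$. Let $\Delta_t=\max_{a\in\mathcal A_t}\langle\phi(x_t,a),\theta^*\rangle-\langle\phi(x_t,a_t),\theta^*\rangle$, $L=\log\big(e+\tfrac{eT\kappa^2}{\lambda}\big)$ and \[ \bar\beta=\sqrt\lambda\,B+\sqrt{4\log T+L\,d_{\mathrm{eff}}(\lambda,T)} . \] Then with probability at least $1-1/T$, \[ \sum_{t=1}^T\Delta_t\le 2\sqrt2\,\bar\beta\,\sqrt{T\,L\,d_{\mathrm{eff}}(\lambda,T)}, \] and consequently the regret satisfies $R_T\le 2+2\sqrt2\,\mathbb E\big[\bar\beta\sqrt{T\,L\,d_{\mathrm{eff}}(\lambda,T)}\big]$. In particular $R_T\lesssim\sqrt T\big(\|\theta^*\|\sqrt{\lambda d_{\mathrm{eff}}(\lambda,T)}+d_{\mathrm{eff}}(\lambda,T)\big)$ up to logarithmic factors in $T$.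
   Context: Setting. $\mathcal X,\mathcal A$ are arbitrary sets; at round $t$ the available actions form a set $\mathcal A_t\subset\mathcal A$. $\mathcal H$ is a real Hilbert space with feature map $\phi:\mathcal X\times\mathcal A\to\mathcal H$, kernel $k(s,s')=\langle\phi(s),\phi(s')\rangle$ with $k(s,s)\le\kappa^2$. Rewards are $r_t=\langle\theta^*,\phi(x_t,a_t)\rangle+\epsilon_t$ with unknown $\theta^*\in\mathcal H$. There is a filtration $(\mathcal F_t)$ such that $x_t$ and $a_t$ are $\mathcal F_{t-1}$-measurable, $\epsilon_t$ is $\mathcal F_t$-measurable and $\mathbb E[\exp(\nu\epsilon_t)\mid\mathcal F_{t-1}]\le\exp(\nu^2/2)$ for every $\mathcal F_{t-1}$-measurable real $\nu$. Notation. $\varphi_t=\phi(x_t,a_t)$; $V_t=\sum_{s\le t}\varphi_s\otimes\varphi_s+\lambda I$; $K_t\in\mathbb R^{t\times t}$, $(K_t)_{ij}=k(s_i,s_j)$ with $s_i=(x_i,a_i)$; $\hat\theta_t=V_t^{-1}\sum_{s\le t}r_s\varphi_s$ ($\hat\theta_0=0$); $\|\theta\|_V=\|V^{1/2}\theta\|$; $d_{\mathrm{eff}}(\lambda,T)=\operatorname{Tr}(K_T(K_T+\lambda I)^{-1})$. K-UCB rule. At round $t$, with $\beta_t=\sqrt\lambda B+\sqrt{2\log\frac1\delta+\log\det(I_{t-1}+\frac1\lambda K_{t-1})}$ (the log-det term being $0$ for $t=1$) and $\mathcal C_t=\{\theta\in\mathcal H:\|\theta-\hat\theta_{t-1}\|_{V_{t-1}}\le\beta_t\}$,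 play $a_t\in\arg\max_{a\in\mathcal A_t}\max_{\theta\in\mathcal C_t}\langle\theta,\phi(x_t,a)\rangle=\arg\max_{a\in\mathcal A_t}\big(\langle\hat\theta_{t-1},\phi(x_t,a)\rangle+\beta_t\|\phi(x_t,a)\|_{V_{t-1}^{-1}}\big)$ (the maximum is assumed to be attained). Regret. $R_T=\mathbb E\big[\sum_{t=1}^T\max_{a\in\mathcal A_t}\langle\theta^*,\phi(x_t,a)\rangle-\sum_{t=1}^T r_t\big]$. *)

theory Defs
  imports "HOL-Probability.Probability"
    "Jordan_Normal_Form.Gauss_Jordan_Elimination" "Jordan_Normal_Form.Determinant"
begin

definition kern :: "('s \<Rightarrow> 'h::real_inner) \<Rightarrow> 's \<Rightarrow> 's \<Rightarrow> real" where
  "kern \<phi> s s' = inner (\<phi> s) (\<phi> s')"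

text \<open>Gram matrix K_t (t x t); row/column i (0-based) corresponds to round i+1.\<close>
definition gram :: "('s \<Rightarrow> 'h::real_inner) \<Rightarrow> (nat \<Rightarrow> 's) \<Rightarrow> nat \<Rightarrow> real mat" where
  "gram \<phi> s t = Matrix.mat t t (\<lambda>(i, j). kern \<phi> (s (Suc i)) (s (Suc j)))"

definition mat_trace :: "real mat \<Rightarrow> real" where
  "mat_trace A = (\<Sum>i<dim_row A. A $$ (i, i))"

definition d_eff :: "('s \<Rightarrow> 'h::real_inner) \<Rightarrow> (nat \<Rightarrow> 's) \<Rightarrow> real \<Rightarrow> nat \<Rightarrow> real" where
  "d_eff \<phi> s lam T =
     mat_trace (gram \<phi> s T * the (mat_inverse (gram \<phi> s T + lam \<cdot>\<^sub>m 1\<^sub>m T)))"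

text \<open>log det(I_t + K_t / lambda)  (equal to 0 for t = 0, empty matrix).\<close>
definition logdet :: "('s \<Rightarrow> 'h::real_inner) \<Rightarrow> (nat \<Rightarrow> 's) \<Rightarrow> real \<Rightarrow> nat \<Rightarrow> real" where
  "logdet \<phi> s lam t = ln (Determinant.det (1\<^sub>m t + (1 / lam) \<cdot>\<^sub>m gram \<phi> s t))"

definition Vop :: "(nat \<Rightarrow> 'h::real_inner) \<Rightarrow> real \<Rightarrow> nat \<Rightarrow> 'h \<Rightarrow> 'h" where
  "Vop f lam t \<theta> = (\<Sum>i=1..t. inner (f i) \<theta> *\<^sub>R f i) + lam *\<^sub>R \<theta>"

definition Vnorm :: "('h \<Rightarrow> 'h) \<Rightarrow> 'h::real_inner \<Rightarrow> real" where
  "Vnorm V \<theta> = sqrt (inner \<theta> (V \<theta>))"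

definition theta_hat :: "(nat \<Rightarrow> 'h::real_inner) \<Rightarrow> (nat \<Rightarrow> real) \<Rightarrow> real \<Rightarrow> nat \<Rightarrow> 'h" where
  "theta_hat f r lam t = inv_into UNIV (Vop f lam t) (\<Sum>i=1..t. r i *\<^sub>R f i)"

definition beta :: "('s \<Rightarrow> 'h::real_inner) \<Rightarrow> (nat \<Rightarrow> 's) \<Rightarrow> real \<Rightarrow> real \<Rightarrow> real \<Rightarrow> nat \<Rightarrow> real" where
  "beta \<phi> s lam B \<delta> t = sqrt lam * B + sqrt (2 * ln (1 / \<delta>) + logdet \<phi> s lam (t - 1))"

definition ucb :: "('x \<times> 'a \<Rightarrow> 'h::real_inner) \<Rightarrow> (nat \<Rightarrow> 'x) \<Rightarrow> (nat \<Rightarrow> 'a) \<Rightarrow> (nat \<Rightarrow> real)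
     \<Rightarrow> real \<Rightarrow> real \<Rightarrow> real \<Rightarrow> nat \<Rightarrow> 'a \<Rightarrow> real" where
  "ucb \<phi> x a r lam B \<delta> t b =
     (let f = (\<lambda>i. \<phi> (x i, a i)) in
      inner (theta_hat f r lam (t - 1)) (\<phi> (x t, b))
      + beta \<phi> (\<lambda>i. (x i, a i)) lam B \<delta> t * Vnorm (inv_into UNIV (Vop f lam (t - 1))) (\<phi> (x t, b)))"

definition kucb_rule :: "('x \<times> 'a \<Rightarrow> 'h::real_inner) \<Rightarrow> (nat \<Rightarrow> 'a set) \<Rightarrow> (nat \<Rightarrow> 'x) \<Rightarrow> (nat \<Rightarrow> 'a)
     \<Rightarrow> (nat \<Rightarrow> real) \<Rightarrow> real \<Rightarrow> real \<Rightarrow> real \<Rightarrow> nat \<Rightarrow> bool" where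
  "kucb_rule \<phi> A x a r lam B \<delta> T \<longleftrightarrow>
     (\<forall>t\<in>{1..T}. a t \<in> A t \<and> (\<forall>b\<in>A t. ucb \<phi> x a r lam B \<delta> t b \<le> ucb \<phi> x a r lam B \<delta> t (a t)))"

end

theory Submission
  imports Defs "Jordan_Normal_Form.Char_Poly"
begin

text \<open>
  Let \<open>W = V\<^sub>n\<inverse>\<close>, \<open>S\<close> the noise sum and \<open>Q = \<langle>S, W S\<rangle>\<close>. The process
  \<open>exp (Q / 2) / sqrt (det (I + K / \<lambda>))\<close> is a nonnegative supermartingale: by Sherman--Morrison its
  one-step ratio is the integral of \<open>exp (g \<epsilon> - g\<^sup>2 / 2)\<close> over a one-dimensional Gaussian \<open>g\<close> with
  predictable mean \<open>\<langle>S, W u\<rangle>\<close> and variance \<open>\<langle>u, W u\<rangle>\<close>, and each such exponential has conditional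
  expectation at most 1. Everything is expressed through kernel values, so no Gaussian measure on
  \<open>H\<close> and no separability is needed. As \<open>\<delta> = 1 / T\<^sup>2\<close>, Markov's inequality in each of the \<open>T\<close> rounds
  and a union bound suffice; no maximal inequality is used.

  On the resulting event optimism gives \<open>\<Delta>\<^sub>t \<le> 2 min (1, \<beta> w\<^sub>t)\<close> with \<open>w\<^sub>t\<^sup>2 = \<langle>\<phi>\<^sub>t, W \<phi>\<^sub>t\<rangle>\<close>, and
  \<open>\<Sum> ln (1 + w\<^sub>t\<^sup>2)\<close> telescopes to the log-determinant. Eigenvalue by eigenvalue,
  \<open>ln (1 + y) \<le> (1 + ln (1 + Y)) y / (1 + y)\<close> for \<open>0 \<le> y \<le> Y\<close> bounds the latter by \<open>L d_eff\<close>.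
\<close>

section \<open>The regularised covariance operator\<close>

lemma linear_Vop: "linear (Vop f l n)"
  by (rule linearI)
     (simp_all add: Vop_def inner_add_right scaleR_add_left scaleR_add_right sum.distrib scaleR_sum_right)

lemma Vop_Suc: "Vop f l (Suc n) h = Vop f l n h + inner (f (Suc n)) h *\<^sub>R f (Suc n)"
  by (simp add: Vop_def)

lemma inner_Vop: "inner g (Vop f l n h) = (\<Sum>i=1..n. inner (f i) h * inner (f i) g) + l * inner g h"
  by (simp add: Vop_def inner_add_right inner_sum_right inner_commute mult.commute)

lemma inner_Vop_commute: "inner g (Vop f l n h) = inner (Vop f l n g) h"
  by (subst inner_commute[of "Vop f l n g"]) (simp add: inner_Vop inner_commute mult.commute)

lemma inner_Vop_ge: "l * inner h h \<le> inner h (Vop f l n h)"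
  by (simp add: inner_Vop sum_nonneg)

text \<open>The quadratic form of \<open>Vop\<close> dominates \<open>l\<close> times the squared
  norm, so the kernel is trivial.\<close>

lemma inj_Vop: assumes "l > 0" shows "inj (Vop f l n)"
proof -
  interpret linear "Vop f l n" by (rule linear_Vop)
  have "h = 0" if "Vop f l n h = 0" for h
  proof -
    have "l * inner h h \<le> 0" using inner_Vop_ge[of l h f n] that by simp
    hence "inner h h \<le> 0" using assms by (simp add: mult_le_0_iff)
    thus ?thesis using inner_ge_zero[of h] by simp
  qed
  thus ?thesis using inj_iff_eq_0 by blast 
qed

text \<open>Sherman-Morrison update of the inverse, one rank-one term at a time. The recursion keeps
  every \<open>inner (f i) (Vinv f l n (f j))\<close> a rational function of kernel values.\<close>

primrec Vinv :: "(nat \<Rightarrow> 'h::real_inner) \<Rightarrow> real \<Rightarrow> nat \<Rightarrow> 'h \<Rightarrow> 'h" where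
  "Vinv f l 0 h = (1 / l) *\<^sub>R h"
| "Vinv f l (Suc n) h = Vinv f l n h -
     (inner (f (Suc n)) (Vinv f l n h) / (1 + inner (f (Suc n)) (Vinv f l n (f (Suc n)))))
       *\<^sub>R Vinv f l n (f (Suc n))"

lemma Vop_Vinv:
  assumes "l > 0" shows "Vop f l n (Vinv f l n h) = h"
proof (induction n arbitrary: h)
  case 0
  show ?case using assms by (simp add: Vop_def)
next
  case (Suc n)
  interpret linear "Vop f l n" by (rule linear_Vop)
  let ?u = "f (Suc n)" and ?W = "Vinv f l n"
  define c where "c = inner ?u (?W h) / (1 + inner ?u (?W ?u))"
  \<comment> \<open>Coercivity at \<open>?W ?u\<close> makes \<open>inner ?u (?W ?u)\<close>
    nonnegative, so the denominator in \<open>c\<close> cannot vanish.\<close>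
  have "0 \<le> l * inner (?W ?u) (?W ?u)" using assms by simp
  also have "\<dots> \<le> inner ?u (?W ?u)"
    using inner_Vop_ge[of l "?W ?u" f n] by (simp add: Suc.IH inner_commute)
  finally have c: "inner ?u (?W h) - c * inner ?u (?W ?u) = c"
    by (simp add: c_def divide_simps) (simp add: algebra_simps)
  have "Vop f l (Suc n) (Vinv f l (Suc n) h) = h - c *\<^sub>R ?u
      + (inner ?u (?W h) - c * inner ?u (?W ?u)) *\<^sub>R ?u"
    by (simp add: Vop_Suc diff scale Suc.IH inner_diff_right c_def)
  thus ?case unfolding c by simp
qed

lemma Vinv_Vop: assumes "l > 0" shows "Vinv f l n (Vop f l n h) = h"
  by (rule injD[OF inj_Vop[OF assms]]) (rule Vop_Vinv[OF assms])

text \<open>Replaces the abstract inverse in \<open>theta_hat\<close> and \<open>ucb\<close> by the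
  explicit recursion.\<close>

lemma inv_Vop: assumes "l > 0" shows "inv_into UNIV (Vop f l n) = Vinv f l n"
  by (rule ext, rule inv_f_eq[OF inj_Vop[OF assms] Vop_Vinv[OF assms]])

lemma linear_Vinv: assumes "l > 0" shows "linear (Vinv f l n)"
proof -
  interpret linear "Vop f l n" by (rule linear_Vop)
  show ?thesis
    by (rule linearI; rule injD[OF inj_Vop[OF assms], of f n])
       (simp_all add: Vop_Vinv[OF assms] add scale)
qed

lemma inner_Vinv_commute: assumes "l > 0"
  shows "inner g (Vinv f l n h) = inner (Vinv f l n g) h"
  using inner_Vop_commute[of "Vinv f l n g" f l n "Vinv f l n h"] by (simp add: Vop_Vinv[OF assms])

lemma inner_Vinv_nonneg: assumes "l > 0" shows "0 \<le> inner h (Vinv f l n h)"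
proof -
  have "0 \<le> l * inner (Vinv f l n h) (Vinv f l n h)" using assms by simp
  also have "\<dots> \<le> inner (Vinv f l n h) h"
    using inner_Vop_ge[of l "Vinv f l n h" f n] by (simp add: Vop_Vinv[OF assms])
  finally show ?thesis by (simp add: inner_commute)
qed

lemma inner_Vinv_Suc: assumes "l > 0"
  shows "inner g (Vinv f l (Suc n) h) = inner g (Vinv f l n h)
    - inner g (Vinv f l n (f (Suc n))) * inner (f (Suc n)) (Vinv f l n h)
      / (1 + inner (f (Suc n)) (Vinv f l n (f (Suc n))))"
  by (simp add: inner_diff_right)

text \<open>Each update subtracts a nonnegative term, so the form is largest at step 0, where it is
  \<open>inner h h / l\<close>.\<close>

lemma inner_Vinv_le: assumes "l > 0" shows "inner h (Vinv f l n h) \<le> inner h h / l"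
proof (induction n)
  case 0
  show ?case by simp
next
  case (Suc n)
  let ?u = "f (Suc n)" and ?W = "Vinv f l n"
  have "0 \<le> inner h (?W ?u) * inner ?u (?W h) / (1 + inner ?u (?W ?u))"
    using inner_Vinv_nonneg[OF assms, of ?u f n] inner_Vinv_commute[OF assms, of h f n ?u]
    by (simp add: inner_commute)
  thus ?case using Suc.IH unfolding inner_Vinv_Suc[OF assms] by linarith
qed

text \<open>Discriminant argument: the form is nonnegative at \<open>g + t *\<^sub>R h\<close> for
  every real \<open>t\<close>.\<close>

lemma Vinv_Cauchy_Schwarz: assumes "l > 0"
  shows "\<bar>inner g (Vinv f l n h)\<bar> \<le> sqrt (inner g (Vinv f l n g)) * sqrt (inner h (Vinv f l n h))"
proof -
  let ?W = "Vinv f l n"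
  interpret linear ?W by (rule linear_Vinv[OF assms])
  define p q s where "p = inner h (?W h)" and "q = inner g (?W h)" and "s = inner g (?W g)"
  have ps: "0 \<le> p" "0 \<le> s" unfolding p_def s_def by (simp_all add: inner_Vinv_nonneg[OF assms])
  have expand: "inner (g + t *\<^sub>R h) (?W (g + t *\<^sub>R h)) = s + 2 * t * q + t\<^sup>2 * p" for t
    using inner_Vinv_commute[OF assms, of h f n g]
    by (simp add: add scale p_def q_def s_def inner_add_left inner_add_right inner_commute
        power2_eq_square algebra_simps)
  have quad: "0 \<le> s + 2 * t * q + t\<^sup>2 * p" for t
    using inner_Vinv_nonneg[OF assms, of "g + t *\<^sub>R h" f n] unfolding expand .
  have "q\<^sup>2 \<le> s * p"
  proof (cases "p = 0")
    case True
    have "q = 0"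
    proof (rule ccontr)
      assume "q \<noteq> 0"
      \<comment> \<open>For \<open>p = 0\<close> the expression is affine in \<open>t\<close>, and
        this \<open>t\<close> gives it the value -1.\<close>
      thus False using quad[of "- (s + 1) / (2 * q)"] True ps by (simp add: field_simps)
    qed
    thus ?thesis using True by simp
  next
    case False
    hence "p > 0" using ps by simp
    \<comment> \<open>\<open>- q / p\<close> minimises the quadratic; the factor \<open>p\<close>
      clears the denominator.\<close>
    have "0 \<le> (s + 2 * (- q / p) * q + (- q / p)\<^sup>2 * p) * p"
      using quad[of "- q / p"] \<open>p > 0\<close> by (intro mult_nonneg_nonneg) auto
    also have "\<dots> = s * p - q\<^sup>2" using \<open>p > 0\<close> by (simp add: field_simps power2_eq_square)
    finally show ?thesis by simp
  qed
  hence "sqrt (q\<^sup>2) \<le> sqrt (s * p)" by (rule real_sqrt_le_mono)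
  thus ?thesis by (simp add: p_def q_def s_def real_sqrt_mult)
qed

text \<open>The vector \<open>b i = \<langle>f i, W u\<rangle>\<close> solves \<open>(l I + K) b = (\<langle>f i, u\<rangle>)\<close>, so subtracting the
  corresponding combination of the first \<open>n\<close> columns clears the last column of the bordered
  matrix up to the pivot \<open>1 + \<langle>u, W u\<rangle>\<close>.\<close>
lemma det_gram_Suc:
  fixes \<phi> :: "'s \<Rightarrow> 'h::real_inner" and s :: "nat \<Rightarrow> 's"
  assumes l: "l > 0"
  defines "f \<equiv> \<lambda>i. \<phi> (s i)"
  shows "Determinant.det (1\<^sub>m (Suc n) + (1/l) \<cdot>\<^sub>m gram \<phi> s (Suc n)) =
    Determinant.det (1\<^sub>m n + (1/l) \<cdot>\<^sub>m gram \<phi> s n) * (1 + inner (f (Suc n)) (Vinv f l n (f (Suc n))))"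
proof -
  let ?u = "f (Suc n)" and ?W = "Vinv f l n"
  define b where "b i = inner (f i) (?W ?u)" for i
  have W: "?u = (\<Sum>i=1..n. b i *\<^sub>R f i) + l *\<^sub>R ?W ?u"
    using Vop_Vinv[OF l, of f n ?u] by (simp add: Vop_def b_def)
  \<comment> \<open>This is \<open>Vop\<close> applied to \<open>?W ?u\<close>, paired with an
    arbitrary \<open>h\<close>. For \<open>h = f (Suc i)\<close> it evaluates row \<open>i\<close>
    of the modified last column.\<close>
  have key: "inner h ?u = (\<Sum>i<n. b (Suc i) * inner h (f (Suc i))) + l * inner h (?W ?u)" for h
    by (subst W) (simp add: inner_add_right inner_sum_right
        sum.shift_bounds_cl_Suc_ivl sum.atLeast1_atMost_eq)
  define A where "A m = 1\<^sub>m m + (1/l) \<cdot>\<^sub>m gram \<phi> s m" for m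
  \<comment> \<open>\<open>C\<close> is unit upper triangular, so multiplying by it leaves the
    determinant unchanged.\<close>
  define C where "C = four_block_mat (1\<^sub>m n) (Matrix.mat n 1 (\<lambda>(i,j). - b (Suc i))) (0\<^sub>m 1 n) (1\<^sub>m 1)"
  define R where "R = four_block_mat (A n) (0\<^sub>m n 1) (Matrix.mat 1 n (\<lambda>(i,j). A (Suc n) $$ (n, j)))
     (Matrix.mat 1 1 (\<lambda>_. 1 + inner ?u (?W ?u)))"
  have cA: "A m \<in> carrier_mat m m" for m by (simp add: A_def gram_def)
  have cC: "C \<in> carrier_mat (Suc n) (Suc n)" unfolding C_def
    using four_block_carrier_mat[of "1\<^sub>m n" n n "1\<^sub>m 1" 1 1] by simp
  have dC: "Determinant.det C = 1" unfolding C_def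
    by (subst det_four_block_mat_lower_left_zero[of _ n _ 1]) auto
  have dR: "Determinant.det R = Determinant.det (A n) * (1 + inner ?u (?W ?u))" unfolding R_def
    by (subst det_four_block_mat_upper_right_zero[of _ n _ 1]) (auto simp: cA det_single)
  have entry: "A m $$ (i,j) = (if i = j then 1 else 0) + inner (f (Suc i)) (f (Suc j)) / l"
    if "i < m" "j < m" for i j m using that by (simp add: A_def gram_def kern_def f_def)
  have "A (Suc n) * C = R"
  proof (rule eq_matI)
    fix i j assume ij: "i < dim_row R" "j < dim_col R"
    hence ij': "i < Suc n" "j < Suc n" using cA[of n] by (auto simp: R_def)
    have "(A (Suc n) * C) $$ (i,j) = (\<Sum>k<Suc n. A (Suc n) $$ (i,k) * C $$ (k,j))"
      using ij' cA[of "Suc n"] cC by (simp add: scalar_prod_def atLeast0LessThan)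
    also have "\<dots> = R $$ (i,j)"
    proof (cases "j < n")
      case True
      have "(\<Sum>k<Suc n. A (Suc n) $$ (i,k) * C $$ (k,j)) = (\<Sum>k<Suc n. if k = j then A (Suc n) $$ (i,k) else 0)"
        by (rule sum.cong) (use True in \<open>auto simp: C_def\<close>)
      also have "\<dots> = A (Suc n) $$ (i,j)" using ij' by simp
      also have "\<dots> = R $$ (i,j)"
        using True ij' cA[of n] by (auto simp: R_def entry less_Suc_eq)
      finally show ?thesis .
    next
      case False
      hence j: "j = n" using ij' by simp
      have "(\<Sum>k<Suc n. A (Suc n) $$ (i,k) * C $$ (k,j)) =
         (\<Sum>k<n. A (Suc n) $$ (i,k) * (- b (Suc k))) + A (Suc n) $$ (i,n)"
        by (simp add: j C_def)
      also have "(\<Sum>k<n. A (Suc n) $$ (i,k) * (- b (Suc k))) =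
         (\<Sum>k<n. (if k = i then - b (Suc k) else 0) - b (Suc k) * inner (f (Suc i)) (f (Suc k)) / l)"
        by (rule sum.cong) (use ij' in \<open>auto simp: entry algebra_simps\<close>)
      also have "\<dots> = (if i < n then - b (Suc i) else 0)
          - (\<Sum>k<n. b (Suc k) * inner (f (Suc i)) (f (Suc k))) / l"
        by (simp add: sum_subtractf sum_divide_distrib)
      also have "A (Suc n) $$ (i,n) = (if i = n then 1 else 0) + inner (f (Suc i)) ?u / l"
        using ij' by (simp add: entry)
      also have "inner (f (Suc i)) ?u / l
         = (\<Sum>k<n. b (Suc k) * inner (f (Suc i)) (f (Suc k))) / l + inner (f (Suc i)) (?W ?u)"
        using l by (subst key) (simp add: field_simps)
      finally show ?thesis
        using ij' cA[of n] by (auto simp: R_def j b_def less_Suc_eq)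
    qed
    finally show "(A (Suc n) * C) $$ (i,j) = R $$ (i,j)" .
  qed (use cA[of n] cA[of "Suc n"] cC in \<open>auto simp: R_def\<close>)
  hence "Determinant.det (A (Suc n)) = Determinant.det R"
    using det_mult[OF cA cC] dC by simp
  thus ?thesis using dR by (simp add: A_def)
qed

lemma det_gram_eq_prod:
  fixes \<phi> :: "'s \<Rightarrow> 'h::real_inner"
  assumes l: "l > 0"
  shows "Determinant.det (1\<^sub>m n + (1/l) \<cdot>\<^sub>m gram \<phi> s n) =
    (\<Prod>t<n. 1 + inner (\<phi> (s (Suc t))) (Vinv (\<lambda>i. \<phi> (s i)) l t (\<phi> (s (Suc t)))))"
proof (induction n)
  case 0
  show ?case by (simp add: det_dim_zero gram_def)
next
  case (Suc n)
  show ?case unfolding det_gram_Suc[OF l] Suc.IH by simp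
qed

text \<open>The logarithm of the product of pivots is a sum over rounds; in this form the
  exploration widths enter the regret.\<close>

lemma logdet_eq_sum:
  fixes \<phi> :: "'s \<Rightarrow> 'h::real_inner"
  assumes l: "l > 0"
  shows "logdet \<phi> s l n = (\<Sum>t<n. ln (1 + inner (\<phi> (s (Suc t))) (Vinv (\<lambda>i. \<phi> (s i)) l t (\<phi> (s (Suc t))))))"
proof -
  have "1 + inner (\<phi> (s (Suc t))) (Vinv (\<lambda>i. \<phi> (s i)) l t (\<phi> (s (Suc t)))) \<noteq> 0" for t
    using inner_Vinv_nonneg[OF l, of "\<phi> (s (Suc t))" "\<lambda>i. \<phi> (s i)" t] by linarith
  thus ?thesis unfolding logdet_def det_gram_eq_prod[OF l] by (intro ln_prod) auto
qed

section \<open>Spectrum of the Gram matrix\<close>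

text \<open>Since \<open>det (K + l I)\<close> is the characteristic polynomial of \<open>- K\<close> at \<open>l\<close>, its logarithmic
  derivative is the trace of the resolvent; factoring the polynomial thus gives the spectral formula
  for \<open>d_eff\<close> without diagonalising \<open>K\<close>.\<close>
lemma char_poly_uminus_eval:
  fixes K :: "real mat"
  assumes K: "K \<in> carrier_mat n n"
  shows "poly (char_poly (- K)) l = Determinant.det (K + l \<cdot>\<^sub>m 1\<^sub>m n)"
proof -
  have "- char_matrix (- K) l = K + l \<cdot>\<^sub>m 1\<^sub>m n"
    using K by (intro eq_matI) (auto simp: char_matrix_def)
  thus ?thesis using char_poly_matrix[of "- K" n l] K by simp
qed

text \<open>The derivative of a characteristic polynomial is the sum of the characteristic
  polynomials of the matrices with row and column \<open>i\<close> deleted. At \<open>l\<close>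
  these are the diagonal cofactors.\<close>

lemma pderiv_char_poly_uminus_eval:
  fixes K :: "real mat"
  assumes K: "K \<in> carrier_mat n n"
  shows "poly (pderiv (char_poly (- K))) l = mat_trace (adj_mat (K + l \<cdot>\<^sub>m 1\<^sub>m n))"
proof -
  let ?A = "K + l \<cdot>\<^sub>m 1\<^sub>m n"
  have "poly (char_poly (mat_delete (- K) i i)) l = adj_mat ?A $$ (i, i)" if i: "i < n" for i
  proof -
    have eq: "mat_delete (- K) i i = - mat_delete K i i"
      using K by (intro eq_matI) (auto simp: mat_delete_def)
    have eq2: "mat_delete K i i + l \<cdot>\<^sub>m 1\<^sub>m (n - 1) = mat_delete ?A i i"
      using K i by (intro eq_matI) (auto simp: mat_delete_def)
    have c: "mat_delete K i i \<in> carrier_mat (n - 1) (n - 1)" using mat_delete_carrier[OF K] .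
    show ?thesis unfolding eq char_poly_uminus_eval[OF c] eq2
      \<comment> \<open>A diagonal cofactor has sign \<open>(-1) ^ (i + i)\<close>; rewriting
        \<open>i + i\<close> as \<open>2 * i\<close> shows that it is 1.\<close>
      using K i by (simp add: adj_mat_def cofactor_def flip: mult_2)
  qed
  thus ?thesis using pderiv_char_poly[of "- K" n] K adj_mat(1)[of ?A n]
    by (simp add: poly_sum mat_trace_def)
qed

text \<open>Over the complex numbers the polynomial splits. Pairing an eigenvector of
  \<open>- K\<close> with its conjugate shows that each root is \<open>- m\<close> with
  \<open>m\<close> real: symmetry cancels the imaginary part, and the two bounds on the form put
  \<open>m\<close> into \<open>{0..Y}\<close>.\<close>

lemma psd_real_char_poly:
  fixes K :: "real mat"
  assumes K: "K \<in> carrier_mat n n"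
    and sym: "\<And>i j. i < n \<Longrightarrow> j < n \<Longrightarrow> K $$ (i,j) = K $$ (j,i)"
    and psd: "\<And>v. 0 \<le> (\<Sum>i<n. \<Sum>j<n. v i * K $$ (i,j) * v j)"
    and bd: "\<And>v. (\<Sum>i<n. \<Sum>j<n. v i * K $$ (i,j) * v j) \<le> Y * (\<Sum>i<n. (v i)\<^sup>2)"
  obtains ms where "length ms = n" "set ms \<subseteq> {0..Y}" "char_poly (- K) = (\<Prod>m\<leftarrow>ms. [:m, 1:])"
proof -
  define A where "A = map_mat complex_of_real (- K)"
  have cA: "A \<in> carrier_mat n n" using K by (simp add: A_def)
  obtain as where as: "char_poly A = (\<Prod> a \<leftarrow> as. [:- a, 1:])" "length as = n"
    using char_poly_factorized[OF cA] by blast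
  have root: "\<exists>m\<in>{0..Y}. a = - complex_of_real m" if a: "a \<in> set as" for a
  proof -
    have "poly (char_poly A) a = 0"
      unfolding as(1) poly_prod_list using a by (auto simp: prod_list_zero_iff image_iff)
    then obtain v where v: "v \<in> carrier_vec n" "v \<noteq> 0\<^sub>v n" "A *\<^sub>v v = a \<cdot>\<^sub>v v"
      using eigenvalue_root_char_poly[OF cA] cA by (auto simp: eigenvalue_def eigenvector_def)
    define w where "w i = vec_index v i" for i
    define x y where "x i = Re (w i)" and "y i = Im (w i)" for i
    have eig: "(\<Sum>j<n. - complex_of_real (K $$ (i,j)) * w j) = a * w i" if i: "i < n" for i
    proof -
      have "vec_index (A *\<^sub>v v) i = vec_index (a \<cdot>\<^sub>v v) i" using v by simp
      thus ?thesis using i v cA K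
        by (simp add: scalar_prod_def A_def w_def atLeast0LessThan)
    qed
    define N where "N = (\<Sum>i<n. (x i)\<^sup>2 + (y i)\<^sup>2)"
    define q where "q u = (\<Sum>i<n. \<Sum>j<n. u i * K $$ (i,j) * u j)" for u :: "nat \<Rightarrow> real"
    have "(\<Sum>i<n. cnj (w i) * (\<Sum>j<n. - complex_of_real (K $$ (i,j)) * w j))
        = (\<Sum>i<n. cnj (w i) * (a * w i))" using eig by simp
    also have "\<dots> = a * complex_of_real N"
      unfolding N_def of_real_sum sum_distrib_left
      by (rule sum.cong) (auto simp: x_def y_def complex_eq_iff power2_eq_square algebra_simps)
    finally have E: "(\<Sum>i<n. \<Sum>j<n. cnj (w i) * (- complex_of_real (K $$ (i,j)) * w j)) = a * complex_of_real N"
      by (simp add: sum_distrib_left)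
    have "(\<Sum>i<n. \<Sum>j<n. y i * (K $$ (i,j) * x j)) = (\<Sum>j<n. \<Sum>i<n. y i * (K $$ (i,j) * x j))"
      by (rule sum.swap)
    also have "\<dots> = (\<Sum>i<n. \<Sum>j<n. x i * (K $$ (i,j) * y j))"
      by (intro sum.cong refl) (auto simp: sym)
    finally have "Im (\<Sum>i<n. \<Sum>j<n. cnj (w i) * (- complex_of_real (K $$ (i,j)) * w j)) = 0"
      by (simp add: x_def y_def sum_subtractf sum_negf)
    hence im: "Im a * N = 0" unfolding E by simp
    have "Re (\<Sum>i<n. \<Sum>j<n. cnj (w i) * (- complex_of_real (K $$ (i,j)) * w j)) = - (q x + q y)"
      by (simp add: q_def x_def y_def sum.distrib sum_subtractf sum_negf algebra_simps)
    hence re: "Re a * N = - (q x + q y)" unfolding E by simp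
    obtain i where i: "i < n" "w i \<noteq> 0" using v unfolding w_def by (auto simp: vec_eq_iff)
    have "0 < (x i)\<^sup>2 + (y i)\<^sup>2"
      using i by (auto simp: x_def y_def complex_eq_iff sum_power2_gt_zero_iff)
    also have "\<dots> \<le> N" unfolding N_def by (rule member_le_sum) (use i in auto)
    finally have N: "N > 0" .
    have "0 \<le> q x + q y" "q x + q y \<le> Y * N"
      using psd[of x] psd[of y] bd[of x] bd[of y]
      by (auto simp: q_def N_def sum.distrib distrib_left)
    hence "0 \<le> (- Re a) * N" "(- Re a) * N \<le> Y * N" using re by auto
    hence "- Re a \<in> {0..Y}"
      using N mult_right_le_imp_le[of "- Re a" N Y] by (auto simp: zero_le_mult_iff mult_le_0_iff)
    moreover have "a = - complex_of_real (- Re a)" using im N by (simp add: complex_eq_iff)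
    ultimately show ?thesis by blast
  qed
  define ms where "ms = map (\<lambda>a. - Re a) as"
  interpret mp: map_poly_inj_comm_ring_hom complex_of_real ..
  \<comment> \<open>All roots being real, the complex factorisation is the image of a real one, and
    injectivity of the embedding of polynomials brings it back.\<close>
  have "map_poly complex_of_real (char_poly (- K)) = char_poly A"
    unfolding A_def by (rule of_real_hom.char_poly_hom[symmetric]) (use K in simp)
  also have "\<dots> = (\<Prod>a\<leftarrow>as. map_poly complex_of_real [:- Re a, 1:])"
    unfolding as(1)
  proof (intro arg_cong[where f = prod_list] map_cong refl)
    fix a assume "a \<in> set as"
    hence "a = complex_of_real (Re a)" using root by force
    thus "[:- a, 1:] = map_poly complex_of_real [:- Re a, 1:]" by (simp add: map_poly_pCons)
  qed
  also have "\<dots> = map_poly complex_of_real (\<Prod>m\<leftarrow>ms. [:m, 1:])"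
    unfolding ms_def mp.hom_prod_list by (simp add: o_def)
  finally have "char_poly (- K) = (\<Prod>m\<leftarrow>ms. [:m, 1:])"
    by (rule mp.injectivity)
  moreover have "length ms = n" "set ms \<subseteq> {0..Y}"
    using as(2) root by (fastforce simp: ms_def)+
  ultimately show ?thesis using that by blast
qed

section \<open>Eigenvalues of the Gram matrix and the effective dimension\<close>

lemma gram_carrier: "gram \<phi> s n \<in> carrier_mat n n"
  by (simp add: gram_def)

lemma gram_quadratic_form:
  "(\<Sum>i<n. \<Sum>j<n. v i * gram \<phi> s n $$ (i,j) * v j) = (norm (\<Sum>i<n. v i *\<^sub>R \<phi> (s (Suc i))))\<^sup>2"
  by (simp add: gram_def kern_def power2_norm_eq_inner inner_sum_left inner_sum_right
      sum_distrib_left mult_ac inner_commute)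

text \<open>Triangle inequality followed by Cauchy-Schwarz. This supplies the upper end of the
  spectrum.\<close>

lemma gram_quadratic_form_le:
  assumes "\<And>s. kern \<phi> s s \<le> \<kappa>\<^sup>2"
  shows "(\<Sum>i<n. \<Sum>j<n. v i * gram \<phi> s n $$ (i,j) * v j) \<le> (real n * \<kappa>\<^sup>2) * (\<Sum>i<n. (v i)\<^sup>2)"
proof -
  have n: "norm (\<phi> z) \<le> \<bar>\<kappa>\<bar>" for z
    using assms[of z] real_sqrt_le_mono by (fastforce simp: kern_def norm_eq_sqrt_inner)
  have "norm (\<Sum>i<n. v i *\<^sub>R \<phi> (s (Suc i))) \<le> (\<Sum>i<n. \<bar>v i\<bar> * \<bar>\<kappa>\<bar>)"
    by (rule sum_norm_le) (simp add: mult_left_mono n)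
  hence "(norm (\<Sum>i<n. v i *\<^sub>R \<phi> (s (Suc i))))\<^sup>2 \<le> (\<Sum>i<n. \<bar>v i\<bar> * \<bar>\<kappa>\<bar>)\<^sup>2"
    by (rule power_mono) simp
  also have "\<dots> \<le> (\<Sum>i<n. (v i)\<^sup>2) * (\<Sum>i<n. \<kappa>\<^sup>2)"
    using Cauchy_Schwarz_ineq_sum[of "\<lambda>i. \<bar>v i\<bar>" "\<lambda>i. \<bar>\<kappa>\<bar>" "{..<n}"] by simp
  finally show ?thesis unfolding gram_quadratic_form by (simp add: mult_ac)
qed

text \<open>Logarithmic derivative of a product of linear factors, by the product rule.\<close>

lemma pderiv_linear_factors_ratio:
  assumes "\<And>m. m \<in> set ms \<Longrightarrow> l + m \<noteq> (0::real)"
  shows "poly (pderiv (\<Prod>m\<leftarrow>ms. [:m, 1:])) l / poly (\<Prod>m\<leftarrow>ms. [:m, 1:]) l = (\<Sum>m\<leftarrow>ms. 1 / (l + m))"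
  using assms
proof (induction ms)
  case (Cons m ms)
  have "poly (\<Prod>m\<leftarrow>ms. [:m, 1:]) l \<noteq> 0"
    using Cons.prems by (auto simp: poly_prod_list prod_list_zero_iff add.commute)
  moreover have "poly (pderiv (\<Prod>m\<leftarrow>m # ms. [:m, 1:])) l
      = poly (\<Prod>m\<leftarrow>ms. [:m, 1:]) l + (l + m) * poly (pderiv (\<Prod>m\<leftarrow>ms. [:m, 1:])) l"
    unfolding list.map prod_list.Cons pderiv_mult by (simp add: pderiv_pCons algebra_simps)
  moreover have "poly (\<Prod>m\<leftarrow>m # ms. [:m, 1:]) l = (l + m) * poly (\<Prod>m\<leftarrow>ms. [:m, 1:]) l"
    by (simp add: algebra_simps)
  moreover have "(p + c * q) / (c * p) = 1 / c + q / p" if "p \<noteq> 0" "c \<noteq> 0" for p q c :: real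
    using that by (simp add: field_simps)
  ultimately show ?case using Cons.IH Cons.prems by (simp del: prod_list.Cons)
qed simp

text \<open>\<open>K (K + l I)^-1 = I - l (K + l I)^-1\<close>, with the inverse written as adjugate
  over determinant. The result is rational in the entries of \<open>K\<close>, which serves both the
  spectral formula and the measurability of \<open>d_eff\<close>.\<close>

lemma d_eff_eq_trace_adj:
  assumes "Determinant.det (gram \<phi> s n + l \<cdot>\<^sub>m 1\<^sub>m n) \<noteq> 0"
  shows "d_eff \<phi> s l n = real n - l * (mat_trace (adj_mat (gram \<phi> s n + l \<cdot>\<^sub>m 1\<^sub>m n))
    / Determinant.det (gram \<phi> s n + l \<cdot>\<^sub>m 1\<^sub>m n))"
proof -
  let ?K = "gram \<phi> s n" let ?A = "?K + l \<cdot>\<^sub>m 1\<^sub>m n" let ?d = "Determinant.det ?A"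
  have cK: "?K \<in> carrier_mat n n" by (rule gram_carrier)
  have cA: "?A \<in> carrier_mat n n" using cK by simp
  \<comment> \<open>Invertibility rules out \<open>None\<close>, so \<open>the\<close> in
    \<open>d_eff\<close> yields a genuine inverse.\<close>
  have "?A \<in> Units (ring_mat TYPE(real) n ())" by (rule det_non_zero_imp_unit[OF cA assms])
  then obtain W where W: "mat_inverse ?A = Some W"
    using mat_inverse(1)[OF cA, where b = "()"] by (cases "mat_inverse ?A") auto
  note Wp = mat_inverse(2)[OF cA W]
  hence cW: "W \<in> carrier_mat n n" by simp
  have cadj: "adj_mat ?A \<in> carrier_mat n n" by (rule adj_mat(1)[OF cA])
  have "adj_mat ?A = adj_mat ?A * (?A * W)" using Wp cadj by simp
  also have "\<dots> = (adj_mat ?A * ?A) * W" using cadj cA cW by (simp add: assoc_mult_mat[of _ n n _ n _ n])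
  also have "\<dots> = ?d \<cdot>\<^sub>m W" unfolding adj_mat(3)[OF cA]
    using cW by (simp add: mult_smult_assoc_mat[of _ n n _ n])
  finally have adj: "adj_mat ?A = ?d \<cdot>\<^sub>m W" .
  have "?A * W = ?K * W + l \<cdot>\<^sub>m W"
    using cK cW by (subst add_mult_distrib_mat[of _ n n _ _ n]) auto
  hence sum1: "?K * W + l \<cdot>\<^sub>m W = 1\<^sub>m n" using Wp by simp
  have "(?K * W) $$ (i,i) = 1 - l * (adj_mat ?A $$ (i,i) / ?d)" if "i < n" for i
  proof -
    have "(?K * W + l \<cdot>\<^sub>m W) $$ (i,i) = 1" unfolding sum1 using that by simp
    thus ?thesis using that cK cW assms unfolding adj by simp
  qed
  hence "d_eff \<phi> s l n = (\<Sum>i<n. 1 - l * (adj_mat ?A $$ (i,i) / ?d))"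
    using cK by (simp add: d_eff_def mat_trace_def W)
  thus ?thesis using cadj
    by (simp add: mat_trace_def sum_subtractf sum_distrib_left sum_divide_distrib)
qed

text \<open>A single list of eigenvalues with multiplicity describes all three quantities, so that
  they can be compared term by term.\<close>

lemma gram_spectrum:
  assumes kappa: "\<And>s. kern \<phi> s s \<le> \<kappa>\<^sup>2" and l: "l > 0"
  obtains ms where "length ms = n" "set ms \<subseteq> {0..real n * \<kappa>\<^sup>2}"
    "Determinant.det (gram \<phi> s n + l \<cdot>\<^sub>m 1\<^sub>m n) = (\<Prod>m\<leftarrow>ms. l + m)"
    "logdet \<phi> s l n = (\<Sum>m\<leftarrow>ms. ln (1 + m / l))"
    "d_eff \<phi> s l n = (\<Sum>m\<leftarrow>ms. m / (m + l))"
proof -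
  let ?K = "gram \<phi> s n"
  have cK: "?K \<in> carrier_mat n n" by (rule gram_carrier)
  obtain ms where ms: "length ms = n" "set ms \<subseteq> {0..real n * \<kappa>\<^sup>2}" "char_poly (- ?K) = (\<Prod>m\<leftarrow>ms. [:m, 1:])"
  proof (rule psd_real_char_poly[OF cK])
    show "?K $$ (i,j) = ?K $$ (j,i)" if "i < n" "j < n" for i j
      using that by (simp add: gram_def kern_def inner_commute)
    show "0 \<le> (\<Sum>i<n. \<Sum>j<n. v i * ?K $$ (i,j) * v j)" for v
      unfolding gram_quadratic_form by simp
    show "(\<Sum>i<n. \<Sum>j<n. v i * ?K $$ (i,j) * v j) \<le> real n * \<kappa>\<^sup>2 * (\<Sum>i<n. (v i)\<^sup>2)" for v
      by (rule gram_quadratic_form_le[OF kappa])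
  qed (use that in blast)
  have pos: "0 \<le> m" if "m \<in> set ms" for m using ms(2) that by auto
  have det: "Determinant.det (?K + x \<cdot>\<^sub>m 1\<^sub>m n) = (\<Prod>m\<leftarrow>ms. x + m)" for x
    unfolding char_poly_uminus_eval[OF cK, symmetric] ms(3) by (simp add: poly_prod_list o_def add.commute)
  have nz: "(\<Prod>m\<leftarrow>ms. l + m) \<noteq> 0" using pos l by (fastforce simp: prod_list_zero_iff)
  have "1\<^sub>m n + (1/l) \<cdot>\<^sub>m ?K = (1/l) \<cdot>\<^sub>m (?K + l \<cdot>\<^sub>m 1\<^sub>m n)"
    using cK l by (intro eq_matI) (auto simp: field_simps)
  hence "Determinant.det (1\<^sub>m n + (1/l) \<cdot>\<^sub>m ?K) = (1/l)^n * (\<Prod>m\<leftarrow>ms. l + m)"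
    using cK by (simp add: det_smult det)
  also have "\<dots> = (\<Prod>m\<leftarrow>ms. 1 + m / l)"
    unfolding ms(1)[symmetric] using l by (induction ms) (auto simp: field_simps)
  also have "ln \<dots> = (\<Sum>m\<leftarrow>ms. ln (1 + m / l))"
  proof -
    have "(\<Prod>m\<leftarrow>ms. 1 + m / l) > 0 \<and> ln (\<Prod>m\<leftarrow>ms. 1 + m / l) = (\<Sum>m\<leftarrow>ms. ln (1 + m / l))"
      using pos
    proof (induction ms)
      case (Cons m ms)
      hence "1 + m / l > 0" using l by (simp add: add_pos_nonneg)
      thus ?case using Cons by (simp add: ln_mult_pos)
    qed simp
    thus ?thesis by simp
  qed
  finally have ld: "logdet \<phi> s l n = (\<Sum>m\<leftarrow>ms. ln (1 + m / l))" by (simp add: logdet_def)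
  \<comment> \<open>Both sides are the logarithmic derivative of \<open>char_poly (- ?K)\<close> at
    \<open>l\<close>.\<close>
  have "mat_trace (adj_mat (?K + l \<cdot>\<^sub>m 1\<^sub>m n)) / Determinant.det (?K + l \<cdot>\<^sub>m 1\<^sub>m n) = (\<Sum>m\<leftarrow>ms. 1 / (l + m))"
    unfolding pderiv_char_poly_uminus_eval[OF cK, symmetric] char_poly_uminus_eval[OF cK, symmetric] ms(3)
    by (rule pderiv_linear_factors_ratio) (use pos l in fastforce)
  hence "d_eff \<phi> s l n = real (length ms) - l * (\<Sum>m\<leftarrow>ms. 1 / (l + m))"
    using d_eff_eq_trace_adj[of \<phi> s n l] nz ms(1) unfolding det by simp
  also have "\<dots> = (\<Sum>m\<leftarrow>ms. m / (m + l))"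
    using pos
  proof (induction ms)
    case (Cons m ms)
    hence "m + l > 0" using l by (simp add: add_nonneg_pos)
    hence "m / (m + l) = 1 - l / (l + m)" by (simp add: divide_simps)
    thus ?case using Cons by (simp add: algebra_simps)
  qed simp
  finally show ?thesis using that[OF ms(1,2) det ld] by blast
qed

text \<open>After multiplication by \<open>1 + y\<close>, the part \<open>y * ln (1 + y)\<close> is
  bounded by monotonicity and the remaining \<open>ln (1 + y)\<close> by \<open>y\<close>.\<close>

lemma ln_le_ratio:
  fixes y Y :: real assumes "0 \<le> y" "y \<le> Y"
  shows "ln (1 + y) \<le> (1 + ln (1 + Y)) * (y / (1 + y))"
proof -
  have "(1 + y) * ln (1 + y) = y * ln (1 + y) + ln (1 + y)" by (simp add: algebra_simps)
  also have "\<dots> \<le> y * ln (1 + Y) + y"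
    using assms by (intro add_mono mult_left_mono ln_add_one_self_le_self) auto
  finally have "(1 + y) * ln (1 + y) \<le> (1 + ln (1 + Y)) * y" by (simp add: algebra_simps)
  thus ?thesis using assms by (simp add: pos_le_divide_eq mult.commute)
qed

text \<open>Each summand \<open>m / (m + l)\<close> lies between 0 and 1. The logarithmic factor
  equals \<open>1 + ln (1 + Y)\<close> with \<open>Y = real n * \<kappa>\<^sup>2 / l\<close>, the
  constant of \<open>ln_le_ratio\<close> for all the ratios \<open>m / l\<close>.\<close>

lemma d_eff_bounds:
  assumes kappa: "\<And>s. kern \<phi> s s \<le> \<kappa>\<^sup>2" and l: "l > 0"
  shows "0 \<le> d_eff \<phi> s l n" "d_eff \<phi> s l n \<le> real n"
    "logdet \<phi> s l n \<le> ln (exp 1 + exp 1 * real n * \<kappa>\<^sup>2 / l) * d_eff \<phi> s l n"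
proof -
  obtain ms where ms: "length ms = n" "set ms \<subseteq> {0..real n * \<kappa>\<^sup>2}"
    "logdet \<phi> s l n = (\<Sum>m\<leftarrow>ms. ln (1 + m / l))" "d_eff \<phi> s l n = (\<Sum>m\<leftarrow>ms. m / (m + l))"
    using gram_spectrum[OF kappa l, of n s] by metis
  show "0 \<le> d_eff \<phi> s l n" unfolding ms(4) by (rule sum_list_nonneg) (use ms(2) l in auto)
  have "d_eff \<phi> s l n \<le> (\<Sum>m\<leftarrow>ms. 1)" unfolding ms(4)
    by (rule sum_list_mono) (use ms(2) l in \<open>auto simp: divide_simps\<close>)
  thus "d_eff \<phi> s l n \<le> real n" using ms(1) by (simp add: sum_list_triv)
  have nn: "0 \<le> real n * \<kappa>\<^sup>2 / l" using l by simp
  have "exp 1 + exp 1 * real n * \<kappa>\<^sup>2 / l = exp 1 * (1 + real n * \<kappa>\<^sup>2 / l)"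
    by (simp add: algebra_simps)
  hence L: "ln (exp 1 + exp 1 * real n * \<kappa>\<^sup>2 / l) = 1 + ln (1 + real n * \<kappa>\<^sup>2 / l)"
    using nn by (simp add: ln_mult del: mult_eq_0_iff)
  have "(\<Sum>m\<leftarrow>ms. ln (1 + m / l)) \<le> (\<Sum>m\<leftarrow>ms. (1 + ln (1 + real n * \<kappa>\<^sup>2 / l)) * (m / (m + l)))"
  proof (rule sum_list_mono)
    fix m assume "m \<in> set ms"
    hence m: "0 \<le> m" "m \<le> real n * \<kappa>\<^sup>2" using ms(2) by auto
    have eq: "(m / l) / (1 + m / l) = m / (m + l)" using m l by (simp add: divide_simps)
    show "ln (1 + m / l) \<le> (1 + ln (1 + real n * \<kappa>\<^sup>2 / l)) * (m / (m + l))"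
      unfolding eq[symmetric] by (rule ln_le_ratio) (use m l in \<open>auto intro: divide_right_mono\<close>)
  qed
  thus "logdet \<phi> s l n \<le> ln (exp 1 + exp 1 * real n * \<kappa>\<^sup>2 / l) * d_eff \<phi> s l n"
    unfolding L ms(3,4) sum_list_const_mult .
qed

section \<open>The self-normalised supermartingale\<close>

lemma nn_integral_normal_density: "\<sigma> > 0 \<Longrightarrow> (\<integral>\<^sup>+z. ennreal (normal_density \<mu> \<sigma> z) \<partial>lborel) = 1"
  by (simp add: nn_integral_eq_integral)

text \<open>Completing the square in \<open>z\<close> turns the integrand into a constant times a
  normal density of mean \<open>c\<close> and variance \<open>1 / (1 + v)\<close>. The
  parametrisation \<open>m + sqrt v * z\<close> covers the degenerate case
  \<open>v = 0\<close>.\<close>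

lemma gaussian_mixture_exp:
  fixes e m v :: real
  assumes v: "v \<ge> 0"
  shows "(\<integral>\<^sup>+z. ennreal (std_normal_density z * exp ((m + sqrt v * z) * e - (m + sqrt v * z)\<^sup>2 / 2)) \<partial>lborel)
    = ennreal (exp ((2 * e * m + e\<^sup>2 * v - m\<^sup>2) / (2 * (1 + v))) / sqrt (1 + v))"
proof -
  define c where "c = sqrt v * (e - m) / (1 + v)"
  define \<sigma> where "\<sigma> = 1 / sqrt (1 + v)"
  define C where "C = exp ((2 * e * m + e\<^sup>2 * v - m\<^sup>2) / (2 * (1 + v))) / sqrt (1 + v)"
  have v1: "1 + v > 0" using v by simp
  have s2: "\<sigma>\<^sup>2 = 1 / (1 + v)" "\<sigma> > 0" using v1 by (simp_all add: \<sigma>_def power_divide)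
  have sv: "(sqrt v)\<^sup>2 = v" using v by simp
  have "std_normal_density z * exp ((m + sqrt v * z) * e - (m + sqrt v * z)\<^sup>2 / 2)
      = C * normal_density c \<sigma> z" for z
  proof -
    have "(z - c)\<^sup>2 * (1 + v) = (1 + v) * z\<^sup>2 - 2 * z * ((1 + v) * c) + ((1 + v) * c)\<^sup>2 / (1 + v)"
      using v1 by (simp add: power2_eq_square field_simps)
    also have "(1 + v) * c = sqrt v * (e - m)" using v1 by (simp add: c_def)
    also have "(sqrt v * (e - m))\<^sup>2 = v * (e - m)\<^sup>2"
      using sv by (simp add: power_mult_distrib)
    finally have sq: "(z - c)\<^sup>2 * (1 + v) = (1 + v) * z\<^sup>2 - 2 * z * (sqrt v * (e - m)) + v * (e - m)\<^sup>2 / (1 + v)" .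
    have A: "(2 * e * m + e\<^sup>2 * v - m\<^sup>2) / (1 + v) = v * (e - m)\<^sup>2 / (1 + v) + 2 * m * e - m\<^sup>2"
      using v1 by (simp add: field_simps power2_eq_square)
    have B: "(m + sqrt v * z)\<^sup>2 = m\<^sup>2 + 2 * m * sqrt v * z + v * z\<^sup>2"
      using sv by (simp add: power2_sum power_mult_distrib)
    have "- z\<^sup>2 / 2 + ((m + sqrt v * z) * e - (m + sqrt v * z)\<^sup>2 / 2)
        = (2 * e * m + e\<^sup>2 * v - m\<^sup>2) / (1 + v) / 2 - (z - c)\<^sup>2 * (1 + v) / 2"
      unfolding sq A B by (simp add: algebra_simps add_divide_distrib diff_divide_distrib)
    hence "exp (- z\<^sup>2 / 2) * exp ((m + sqrt v * z) * e - (m + sqrt v * z)\<^sup>2 / 2)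
        = exp ((2 * e * m + e\<^sup>2 * v - m\<^sup>2) / (2 * (1 + v))) * exp (- (z - c)\<^sup>2 * (1 + v) / 2)"
      unfolding exp_add[symmetric] by (simp add: mult.commute)
    moreover have "normal_density c \<sigma> z = sqrt (1 + v) / sqrt (2 * pi) * exp (- (z - c)\<^sup>2 * (1 + v) / 2)"
      unfolding normal_density_def s2(1) by (simp add: real_sqrt_divide)
    ultimately show ?thesis using v1 by (simp add: std_normal_density_def C_def)
  qed
  hence "(\<integral>\<^sup>+z. ennreal (std_normal_density z * exp ((m + sqrt v * z) * e - (m + sqrt v * z)\<^sup>2 / 2)) \<partial>lborel)
     = (\<integral>\<^sup>+z. ennreal C * ennreal (normal_density c \<sigma> z) \<partial>lborel)"
    using v1 by (simp add: C_def ennreal_mult[symmetric])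
  also have "\<dots> = ennreal C" using s2(2) by (simp add: nn_integral_cmult nn_integral_normal_density)
  finally show ?thesis unfolding C_def .
qed

text \<open>Writing the integrand as a Gaussian mixture over \<open>g = m + sqrt v z\<close>, Tonelli reduces the claim
  to the sub-Gaussian bound for each fixed \<open>z\<close>.\<close>
lemma nn_integral_mixture_step:
  fixes m v e :: "'w \<Rightarrow> real" and U :: "'w \<Rightarrow> ennreal"
  assumes P: "prob_space M" and sub: "subalgebra M G"
    and meas: "U \<in> borel_measurable G" "m \<in> borel_measurable G" "v \<in> borel_measurable G" "e \<in> borel_measurable M"
    and v: "\<And>\<omega>. v \<omega> \<ge> 0"
    and subgauss: "\<And>\<nu>. \<nu> \<in> borel_measurable G \<Longrightarrow>
        AE \<omega> in M. nn_cond_exp M G (\<lambda>\<omega>. ennreal (exp (\<nu> \<omega> * e \<omega>))) \<omega> \<le> ennreal (exp ((\<nu> \<omega>)\<^sup>2 / 2))"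
  shows "(\<integral>\<^sup>+\<omega>. U \<omega> * ennreal (exp ((2 * e \<omega> * m \<omega> + (e \<omega>)\<^sup>2 * v \<omega> - (m \<omega>)\<^sup>2) / (2 * (1 + v \<omega>))) / sqrt (1 + v \<omega>)) \<partial>M)
     \<le> (\<integral>\<^sup>+\<omega>. U \<omega> \<partial>M)"
proof -
  interpret prob_space M by fact
  interpret finite_measure_subalgebra M G by (unfold_locales) (rule sub)
  interpret pair_sigma_finite lborel M ..
  note [measurable] = meas
  have [measurable]: "U \<in> borel_measurable M" "m \<in> borel_measurable M" "v \<in> borel_measurable M"
    by (intro measurable_from_subalg[OF sub] meas)+
  define g where "g z \<omega> = m \<omega> + sqrt (v \<omega>) * z" for z \<omega>
  have [measurable]: "(\<lambda>(z, \<omega>). g z \<omega>) \<in> borel_measurable (lborel \<Otimes>\<^sub>M M)" unfolding g_def by measurable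
  have gG[measurable]: "g z \<in> borel_measurable G" for z unfolding g_def by measurable
  have fixed: "(\<integral>\<^sup>+\<omega>. U \<omega> * ennreal (exp (g z \<omega> * e \<omega> - (g z \<omega>)\<^sup>2 / 2)) \<partial>M) \<le> (\<integral>\<^sup>+\<omega>. U \<omega> \<partial>M)" for z
  proof -
    have [measurable]: "g z \<in> borel_measurable M" using measurable_from_subalg[OF sub gG] .
    \<comment> \<open>The factor \<open>exp (- (g z \<omega>)\<^sup>2 / 2)\<close> is
      \<open>G\<close>-measurable and joins the weight \<open>U\<close>; only the exponential
      containing \<open>e\<close> is conditioned.\<close>
    define h where "h \<omega> = U \<omega> * ennreal (exp (- (g z \<omega>)\<^sup>2 / 2))" for \<omega>
    have h[measurable]: "h \<in> borel_measurable G" unfolding h_def by measurable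
    have "(\<integral>\<^sup>+\<omega>. U \<omega> * ennreal (exp (g z \<omega> * e \<omega> - (g z \<omega>)\<^sup>2 / 2)) \<partial>M)
      = (\<integral>\<^sup>+\<omega>. h \<omega> * ennreal (exp (g z \<omega> * e \<omega>)) \<partial>M)"
      by (rule nn_integral_cong)
         (simp add: h_def mult.assoc ennreal_mult[symmetric] exp_add[symmetric])
    also have "\<dots> = (\<integral>\<^sup>+\<omega>. h \<omega> * nn_cond_exp M G (\<lambda>\<omega>. ennreal (exp (g z \<omega> * e \<omega>))) \<omega> \<partial>M)"
      by (rule nn_cond_exp_intg[symmetric]) measurable
    also have "\<dots> \<le> (\<integral>\<^sup>+\<omega>. h \<omega> * ennreal (exp ((g z \<omega>)\<^sup>2 / 2)) \<partial>M)"
      using subgauss[OF gG[of z]] by (intro nn_integral_mono_AE) (auto elim!: eventually_mono intro: mult_left_mono)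
    also have "\<dots> = (\<integral>\<^sup>+\<omega>. U \<omega> \<partial>M)"
      by (rule nn_integral_cong)
         (simp add: h_def mult.assoc ennreal_mult[symmetric] exp_add[symmetric])
    finally show ?thesis .
  qed
  have "(\<integral>\<^sup>+\<omega>. U \<omega> * ennreal (exp ((2 * e \<omega> * m \<omega> + (e \<omega>)\<^sup>2 * v \<omega> - (m \<omega>)\<^sup>2) / (2 * (1 + v \<omega>))) / sqrt (1 + v \<omega>)) \<partial>M)
     = (\<integral>\<^sup>+\<omega>. U \<omega> * (\<integral>\<^sup>+z. ennreal (std_normal_density z * exp (g z \<omega> * e \<omega> - (g z \<omega>)\<^sup>2 / 2)) \<partial>lborel) \<partial>M)"
    unfolding g_def gaussian_mixture_exp[OF v] ..
  also have "\<dots> = (\<integral>\<^sup>+\<omega>. (\<integral>\<^sup>+z. U \<omega> * ennreal (std_normal_density z * exp (g z \<omega> * e \<omega> - (g z \<omega>)\<^sup>2 / 2)) \<partial>lborel) \<partial>M)"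
    by (intro nn_integral_cong nn_integral_cmult[symmetric]) (simp add: g_def)
  also have "\<dots> = (\<integral>\<^sup>+z. (\<integral>\<^sup>+\<omega>. U \<omega> * ennreal (std_normal_density z * exp (g z \<omega> * e \<omega> - (g z \<omega>)\<^sup>2 / 2)) \<partial>M) \<partial>lborel)"
    by (rule Fubini') measurable
  also have "\<dots> = (\<integral>\<^sup>+z. ennreal (std_normal_density z) * (\<integral>\<^sup>+\<omega>. U \<omega> * ennreal (exp (g z \<omega> * e \<omega> - (g z \<omega>)\<^sup>2 / 2)) \<partial>M) \<partial>lborel)"
  proof (rule nn_integral_cong)
    fix z :: real
    have [measurable]: "g z \<in> borel_measurable M" using measurable_from_subalg[OF sub gG] .
    show "(\<integral>\<^sup>+\<omega>. U \<omega> * ennreal (std_normal_density z * exp (g z \<omega> * e \<omega> - (g z \<omega>)\<^sup>2 / 2)) \<partial>M)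
      = ennreal (std_normal_density z) * (\<integral>\<^sup>+\<omega>. U \<omega> * ennreal (exp (g z \<omega> * e \<omega> - (g z \<omega>)\<^sup>2 / 2)) \<partial>M)"
      by (subst nn_integral_cmult[symmetric]) (auto simp: ennreal_mult mult_ac)
  qed
  also have "\<dots> \<le> (\<integral>\<^sup>+z. ennreal (std_normal_density z) * (\<integral>\<^sup>+\<omega>. U \<omega> \<partial>M) \<partial>lborel)"
    by (intro nn_integral_mono mult_left_mono fixed) simp
  also have "\<dots> = (\<integral>\<^sup>+\<omega>. U \<omega> \<partial>M)" by (simp add: nn_integral_multc nn_integral_normal_density)
  finally show ?thesis .
qed

text \<open>Every step of the recursion is a rational expression in the scalars of the previous
  step, so measurability of the kernel values suffices. The indices range beyond \<open>k\<close>
  because the step to \<open>Suc k\<close> involves the vector \<open>f (Suc k)\<close>.\<close>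

lemma borel_measurable_inner_Vinv:
  fixes f :: "nat \<Rightarrow> 'w \<Rightarrow> 'h::real_inner"
  assumes gram: "\<And>i j. i \<in> {1..N} \<Longrightarrow> j \<in> {1..N} \<Longrightarrow> (\<lambda>\<omega>. inner (f i \<omega>) (f j \<omega>)) \<in> borel_measurable G"
    and l: "l > 0"
  shows "k \<le> N \<Longrightarrow> i \<in> {1..N} \<Longrightarrow> j \<in> {1..N} \<Longrightarrow>
    (\<lambda>\<omega>. inner (f i \<omega>) (Vinv (\<lambda>i. f i \<omega>) l k (f j \<omega>))) \<in> borel_measurable G"
proof (induction k arbitrary: i j)
  case 0
  thus ?case using gram by simp
next
  case (Suc k)
  have [measurable]: "(\<lambda>\<omega>. inner (f i' \<omega>) (Vinv (\<lambda>i. f i \<omega>) l k (f j' \<omega>))) \<in> borel_measurable G"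
    if "i' \<in> {i, Suc k}" "j' \<in> {j, Suc k}" for i' j'
    using that Suc.prems by (intro Suc.IH) auto
  show ?case unfolding inner_Vinv_Suc[OF l] by (measurable; simp)
qed

text \<open>Sherman-Morrison once more. Over the common denominator the increment is exactly twice
  the exponent in \<open>gaussian_mixture_exp\<close>.\<close>

lemma inner_Vinv_Suc_add:
  fixes f :: "nat \<Rightarrow> 'h::real_inner" and n :: nat
  assumes l: "l > 0"
  defines "u \<equiv> f (Suc n)"
  shows "inner (S + e *\<^sub>R u) (Vinv f l (Suc n) (S + e *\<^sub>R u)) = inner S (Vinv f l n S)
    + (2 * e * inner S (Vinv f l n u) + e\<^sup>2 * inner u (Vinv f l n u) - (inner S (Vinv f l n u))\<^sup>2)
      / (1 + inner u (Vinv f l n u))"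
proof -
  interpret linear "Vinv f l n" by (rule linear_Vinv[OF l])
  define m v where "m = inner S (Vinv f l n u)" and "v = inner u (Vinv f l n u)"
  have m': "inner u (Vinv f l n S) = m"
    unfolding m_def using inner_Vinv_commute[OF l, of u f n S] by (simp add: inner_commute)
  have v1: "1 + v > 0" using inner_Vinv_nonneg[OF l, of u f n] by (simp add: v_def)
  have "inner (S + e *\<^sub>R u) (Vinv f l (Suc n) (S + e *\<^sub>R u))
     = inner S (Vinv f l n S) + 2 * e * m + e\<^sup>2 * v - (m + e * v) * (m + e * v) / (1 + v)"
    unfolding inner_Vinv_Suc[OF l] u_def[symmetric] add scale
    by (simp add: inner_add_left inner_add_right m' m_def[symmetric] v_def[symmetric]
        power2_eq_square algebra_simps)
  also have "2 * e * m + e\<^sup>2 * v - (m + e * v) * (m + e * v) / (1 + v) = (2 * e * m + e\<^sup>2 * v - m\<^sup>2) / (1 + v)"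
    using v1 by (simp add: field_simps power2_eq_square)
  hence "inner S (Vinv f l n S) + 2 * e * m + e\<^sup>2 * v - (m + e * v) * (m + e * v) / (1 + v)
     = inner S (Vinv f l n S) + (2 * e * m + e\<^sup>2 * v - m\<^sup>2) / (1 + v)" by linarith
  finally show ?thesis unfolding m_def v_def .
qed

section \<open>The self-normalised process and its expectation\<close>

definition noise_sum :: "(nat \<Rightarrow> 'h::real_inner) \<Rightarrow> (nat \<Rightarrow> real) \<Rightarrow> nat \<Rightarrow> 'h" where
  "noise_sum f e n = (\<Sum>i=1..n. e i *\<^sub>R f i)"

text \<open>By \<open>det_gram_eq_prod\<close> the product under the root is
  \<open>det (I + K / l)\<close>; as a product it makes the one-step ratio visible.\<close>

definition self_normalized :: "(nat \<Rightarrow> 'h::real_inner) \<Rightarrow> (nat \<Rightarrow> real) \<Rightarrow> real \<Rightarrow> nat \<Rightarrow> real" where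
  "self_normalized f e l n = exp (inner (noise_sum f e n) (Vinv f l n (noise_sum f e n)) / 2)
     / sqrt (\<Prod>t<n. 1 + inner (f (Suc t)) (Vinv f l t (f (Suc t))))"

text \<open>The new factor is the value of the integral in \<open>gaussian_mixture_exp\<close>.
  Writing \<open>m\<close> as a sum of scalars lets its measurability be read off from
  \<open>borel_measurable_inner_Vinv\<close>.\<close>

lemma self_normalized_Suc:
  fixes f :: "nat \<Rightarrow> 'h::real_inner" and e :: "nat \<Rightarrow> real" and n :: nat
  assumes l: "l > 0"
  defines "v \<equiv> inner (f (Suc n)) (Vinv f l n (f (Suc n)))"
    and "m \<equiv> (\<Sum>i=1..n. e i * inner (f i) (Vinv f l n (f (Suc n))))"
  shows "self_normalized f e l (Suc n) = self_normalized f e l n *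
    (exp ((2 * e (Suc n) * m + (e (Suc n))\<^sup>2 * v - m\<^sup>2) / (2 * (1 + v))) / sqrt (1 + v))"
proof -
  have "noise_sum f e (Suc n) = noise_sum f e n + e (Suc n) *\<^sub>R f (Suc n)" by (simp add: noise_sum_def)
  moreover have "inner (noise_sum f e n) (Vinv f l n (f (Suc n))) = m"
    by (simp add: noise_sum_def m_def inner_sum_left)
  ultimately show ?thesis
    unfolding self_normalized_def
    by (simp add: inner_Vinv_Suc_add[OF l] v_def[symmetric] real_sqrt_mult add_divide_distrib exp_add mult.commute
        del: Vinv.simps)
qed

text \<open>Measurability and bound are proved in one induction, since the previous value is the
  \<open>F n\<close>-measurable weight in \<open>nn_integral_mixture_step\<close>.\<close>

lemma nn_integral_self_normalized:
  fixes f :: "nat \<Rightarrow> 'w \<Rightarrow> 'h::real_inner" and \<epsilon> :: "nat \<Rightarrow> 'w \<Rightarrow> real"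
  assumes P: "prob_space M"
    and filt: "\<And>n. subalgebra M (F n)" "\<And>m n. m \<le> n \<Longrightarrow> subalgebra (F n) (F m)"
    and gram: "\<And>i j n. i \<in> {1..Suc n} \<Longrightarrow> j \<in> {1..Suc n} \<Longrightarrow> (\<lambda>\<omega>. inner (f i \<omega>) (f j \<omega>)) \<in> borel_measurable (F n)"
    and eps: "\<And>t. t \<ge> 1 \<Longrightarrow> \<epsilon> t \<in> borel_measurable (F t)"
    and subgauss: "\<And>t \<nu>. t \<ge> 1 \<Longrightarrow> \<nu> \<in> borel_measurable (F (t - 1)) \<Longrightarrow>
        AE \<omega> in M. nn_cond_exp M (F (t - 1)) (\<lambda>\<omega>. ennreal (exp (\<nu> \<omega> * \<epsilon> t \<omega>))) \<omega>
                     \<le> ennreal (exp ((\<nu> \<omega>)\<^sup>2 / 2))"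
    and l: "l > 0"
  shows "(\<lambda>\<omega>. self_normalized (\<lambda>i. f i \<omega>) (\<lambda>i. \<epsilon> i \<omega>) l n) \<in> borel_measurable (F n)
    \<and> (\<integral>\<^sup>+\<omega>. ennreal (self_normalized (\<lambda>i. f i \<omega>) (\<lambda>i. \<epsilon> i \<omega>) l n) \<partial>M) \<le> 1"
proof (induction n)
  case 0
  interpret prob_space M by fact
  show ?case by (simp add: self_normalized_def noise_sum_def emeasure_space_1)
next
  case (Suc n)
  let ?q = "\<lambda>i \<omega>. inner (f i \<omega>) (Vinv (\<lambda>i. f i \<omega>) l n (f (Suc n) \<omega>))"
  define v where "v \<omega> = ?q (Suc n) \<omega>" for \<omega>
  define m where "m \<omega> = (\<Sum>i=1..n. \<epsilon> i \<omega> * ?q i \<omega>)" for \<omega>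
  define U where "U \<omega> = self_normalized (\<lambda>i. f i \<omega>) (\<lambda>i. \<epsilon> i \<omega>) l n" for \<omega>
  \<comment> \<open>The index \<open>Suc n\<close> is admissible because the features of round
    \<open>Suc n\<close> are already determined at time \<open>n\<close>.\<close>
  have q: "?q i \<in> borel_measurable (F n)" if "i \<in> {1..Suc n}" for i
    by (rule borel_measurable_inner_Vinv[where N = "Suc n"]) (use gram l that in auto)
  have v[measurable]: "v \<in> borel_measurable (F n)" unfolding v_def by (rule q) simp
  have m[measurable]: "m \<in> borel_measurable (F n)" unfolding m_def
    using q measurable_from_subalg[OF filt(2) eps]
    by (intro borel_measurable_sum borel_measurable_times) auto
  have U: "U \<in> borel_measurable (F n)" "(\<integral>\<^sup>+\<omega>. ennreal (U \<omega>) \<partial>M) \<le> 1"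
    using Suc.IH by (auto simp: U_def[abs_def])
  have rec: "self_normalized (\<lambda>i. f i \<omega>) (\<lambda>i. \<epsilon> i \<omega>) l (Suc n) = U \<omega> *
      (exp ((2 * \<epsilon> (Suc n) \<omega> * m \<omega> + (\<epsilon> (Suc n) \<omega>)\<^sup>2 * v \<omega> - (m \<omega>)\<^sup>2) / (2 * (1 + v \<omega>))) / sqrt (1 + v \<omega>))" for \<omega>
    unfolding self_normalized_Suc[OF l] U_def m_def v_def ..
  have [measurable]: "U \<in> borel_measurable (F (Suc n))" "m \<in> borel_measurable (F (Suc n))"
    "v \<in> borel_measurable (F (Suc n))" "\<epsilon> (Suc n) \<in> borel_measurable (F (Suc n))"
    using measurable_from_subalg[OF filt(2)[of n "Suc n"] U(1)]
      measurable_from_subalg[OF filt(2)[of n "Suc n"] m]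
      measurable_from_subalg[OF filt(2)[of n "Suc n"] v] eps[of "Suc n"] by simp_all
  have v0: "v \<omega> \<ge> 0" for \<omega> unfolding v_def by (rule inner_Vinv_nonneg[OF l])
  have U0: "U \<omega> \<ge> 0" for \<omega>
    unfolding U_def self_normalized_def
    by (intro divide_nonneg_nonneg real_sqrt_ge_zero prod_nonneg) (auto simp: inner_Vinv_nonneg[OF l])
  have "(\<integral>\<^sup>+\<omega>. ennreal (self_normalized (\<lambda>i. f i \<omega>) (\<lambda>i. \<epsilon> i \<omega>) l (Suc n)) \<partial>M)
      = (\<integral>\<^sup>+\<omega>. ennreal (U \<omega>) * ennreal (exp ((2 * \<epsilon> (Suc n) \<omega> * m \<omega> + (\<epsilon> (Suc n) \<omega>)\<^sup>2 * v \<omega> - (m \<omega>)\<^sup>2) / (2 * (1 + v \<omega>))) / sqrt (1 + v \<omega>)) \<partial>M)"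
    unfolding rec using U0 v0 by (simp add: ennreal_mult[symmetric])
  also have "\<dots> \<le> (\<integral>\<^sup>+\<omega>. ennreal (U \<omega>) \<partial>M)"
    using subgauss[of "Suc n"] U(1) v m v0 measurable_from_subalg[OF filt(1) eps[of "Suc n"]]
    by (intro nn_integral_mixture_step[OF P filt(1)[of n]]) auto
  finally show ?case using U(2) unfolding rec by auto
qed

section \<open>Regret of K-UCB\<close>

text \<open>For the mean \<open>m\<close>, \<open>\<nu> * m\<close> stays below
  \<open>exp (\<nu>\<^sup>2 / 2) - 1\<close>, which is quadratic near 0; taking both signs of
  \<open>\<nu>\<close> forces \<open>m = 0\<close>. The noise thus drops out of the expected
  regret.\<close>

lemma subgaussian_centered:
  fixes e :: "'w \<Rightarrow> real"
  assumes P: "prob_space M" and e[measurable]: "e \<in> borel_measurable M"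
    and mgf: "\<And>\<nu>. (\<integral>\<^sup>+\<omega>. ennreal (exp (\<nu> * e \<omega>)) \<partial>M) \<le> ennreal (exp (\<nu>\<^sup>2 / 2))"
  shows "integrable M e" "(\<integral>\<omega>. e \<omega> \<partial>M) = 0"
proof -
  interpret prob_space M by fact
  have int: "integrable M (\<lambda>\<omega>. exp (\<nu> * e \<omega>))" for \<nu>
    using mgf[of \<nu>] by (intro integrableI_bounded) (auto simp: le_less_trans)
  have le: "(\<integral>\<omega>. exp (\<nu> * e \<omega>) \<partial>M) \<le> exp (\<nu>\<^sup>2 / 2)" for \<nu>
    using mgf[of \<nu>] nn_integral_eq_integral[OF int[of \<nu>]] by simp
  have bd: "\<bar>y\<bar> \<le> exp y + exp (- y)" for y :: real
    using exp_ge_add_one_self[of y] exp_ge_add_one_self[of "- y"] exp_gt_zero[of y] exp_gt_zero[of "- y"]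
    by linarith
  have "integrable M (\<lambda>\<omega>. exp (e \<omega>) + exp (- e \<omega>))"
    using Bochner_Integration.integrable_add[OF int[of 1] int[of "- 1"]] by simp
  thus ie: "integrable M e"
    by (rule Bochner_Integration.integrable_bound[OF _ e]) (simp add: bd)
  define m where "m = (\<integral>\<omega>. e \<omega> \<partial>M)"
  have lin: "\<nu> * m + 1 \<le> exp (\<nu>\<^sup>2 / 2)" for \<nu>
  proof -
    have "\<nu> * m + 1 = (\<integral>\<omega>. \<nu> * e \<omega> + 1 \<partial>M)" using ie by (simp add: m_def prob_space)
    also have "\<dots> \<le> (\<integral>\<omega>. exp (\<nu> * e \<omega>) \<partial>M)"
      using ie int by (intro integral_mono) (auto simp: add.commute)
    finally show ?thesis using le[of \<nu>] by linarith
  qed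
  have "m = 0"
  proof (rule ccontr)
    assume "m \<noteq> 0"
    \<comment> \<open>\<open>d \<le> 1\<close> gives
      \<open>exp (d\<^sup>2 / 2) \<le> 1 + d\<^sup>2\<close>, hence
      \<open>d * \<bar>m\<bar> \<le> d * d\<close>, contradicting
      \<open>d < \<bar>m\<bar>\<close>.\<close>
    define d where "d = min 1 (\<bar>m\<bar> / 2)"
    have d: "0 < d" "d \<le> 1" "d < \<bar>m\<bar>" using \<open>m \<noteq> 0\<close> by (auto simp: d_def)
    have d2: "d\<^sup>2 \<le> 1" using d by (simp add: power_le_one)
    have "d * \<bar>m\<bar> + 1 = sgn m * d * m + 1" by (simp add: abs_if sgn_if)
    also have "\<dots> \<le> exp ((sgn m * d)\<^sup>2 / 2)" by (rule lin)
    also have "(sgn m * d)\<^sup>2 = d\<^sup>2" using \<open>m \<noteq> 0\<close> by (simp add: sgn_if)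
    also have "exp (d\<^sup>2 / 2) \<le> 1 + d\<^sup>2 / 2 + (d\<^sup>2 / 2)\<^sup>2" using d2 by (intro exp_bound) auto
    also have "(d\<^sup>2 / 2)\<^sup>2 \<le> d\<^sup>2 / 2"
      unfolding power2_eq_square[of "d\<^sup>2 / 2"] using d2 by (intro mult_left_le) auto
    finally have "d * \<bar>m\<bar> \<le> d * d" by (simp add: power2_eq_square)
    thus False using d by simp
  qed
  thus "(\<integral>\<omega>. e \<omega> \<partial>M) = 0" by (simp add: m_def)
qed

text \<open>The estimation error is \<open>W S - l W \<theta>s\<close>. Cauchy-Schwarz for the form
  of \<open>W\<close> bounds the noise part, and together with \<open>inner_Vinv_le\<close> also the
  regularisation bias.\<close>

lemma theta_hat_error:
  fixes f :: "nat \<Rightarrow> 'h::real_inner" and e :: "nat \<Rightarrow> real" and n :: nat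
  assumes l: "l > 0" and B: "norm \<theta>s \<le> B"
  defines "S \<equiv> noise_sum f e n"
  shows "\<bar>inner (theta_hat f (\<lambda>i. inner \<theta>s (f i) + e i) l n) u - inner \<theta>s u\<bar>
    \<le> (sqrt l * B + sqrt (inner S (Vinv f l n S))) * Vnorm (inv_into UNIV (Vop f l n)) u"
proof -
  let ?W = "Vinv f l n"
  interpret linear ?W by (rule linear_Vinv[OF l])
  have "(\<Sum>i=1..n. (inner \<theta>s (f i) + e i) *\<^sub>R f i) = Vop f l n \<theta>s - l *\<^sub>R \<theta>s + S"
    by (simp add: Vop_def S_def noise_sum_def scaleR_add_left sum.distrib inner_commute)
  hence "theta_hat f (\<lambda>i. inner \<theta>s (f i) + e i) l n = \<theta>s - l *\<^sub>R ?W \<theta>s + ?W S"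
    by (simp add: theta_hat_def inv_Vop[OF l] add diff scale Vinv_Vop[OF l])
  hence "inner (theta_hat f (\<lambda>i. inner \<theta>s (f i) + e i) l n) u - inner \<theta>s u
     = inner S (?W u) - l * inner \<theta>s (?W u)"
    by (simp add: inner_add_left inner_diff_left inner_Vinv_commute[OF l])
  moreover have "\<bar>inner S (?W u)\<bar> \<le> sqrt (inner S (?W S)) * sqrt (inner u (?W u))"
    by (rule Vinv_Cauchy_Schwarz[OF l])
  moreover have "l * \<bar>inner \<theta>s (?W u)\<bar> \<le> sqrt l * B * sqrt (inner u (?W u))"
  proof -
    have "sqrt (inner \<theta>s (?W \<theta>s)) \<le> sqrt (inner \<theta>s \<theta>s / l)"
      by (rule real_sqrt_le_mono[OF inner_Vinv_le[OF l]])
    also have "\<dots> = norm \<theta>s / sqrt l" by (simp add: real_sqrt_divide norm_eq_sqrt_inner)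
    also have "\<dots> \<le> B / sqrt l" using B l by (simp add: divide_right_mono)
    finally have "l * (sqrt (inner \<theta>s (?W \<theta>s)) * sqrt (inner u (?W u))) \<le> l * (B / sqrt l * sqrt (inner u (?W u)))"
      using l inner_Vinv_nonneg[OF l] by (intro mult_left_mono mult_right_mono) auto
    moreover have "l * (B / sqrt l * sqrt (inner u (?W u))) = l / sqrt l * B * sqrt (inner u (?W u))" by simp
    hence "l * (B / sqrt l * sqrt (inner u (?W u))) = sqrt l * B * sqrt (inner u (?W u))"
      using l by (simp only: real_div_sqrt less_imp_le)
    moreover have "l * \<bar>inner \<theta>s (?W u)\<bar> \<le> l * (sqrt (inner \<theta>s (?W \<theta>s)) * sqrt (inner u (?W u)))"
      using l by (intro mult_left_mono Vinv_Cauchy_Schwarz) auto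
    ultimately show ?thesis by linarith
  qed
  ultimately show ?thesis
    using l abs_triangle_ineq4[of "inner S (?W u)" "l * inner \<theta>s (?W u)"]
    by (simp add: Vnorm_def inv_Vop[OF l] abs_mult distrib_right)
qed

text \<open>For \<open>c = 1 / \<delta>\<close> the right-hand side is the expression under the root
  in \<open>beta\<close> at round \<open>n + 1\<close>.\<close>

lemma self_normalized_le_imp:
  fixes \<phi> :: "'s \<Rightarrow> 'h::real_inner" and s :: "nat \<Rightarrow> 's" and e :: "nat \<Rightarrow> real" and n :: nat
  assumes l: "l > 0" and c: "c > 0"
    and le: "self_normalized (\<lambda>i. \<phi> (s i)) e l n \<le> c"
  defines "S \<equiv> noise_sum (\<lambda>i. \<phi> (s i)) e n"
  shows "inner S (Vinv (\<lambda>i. \<phi> (s i)) l n S) \<le> 2 * ln c + logdet \<phi> s l n"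
proof -
  define D where "D = (\<Prod>t<n. 1 + inner (\<phi> (s (Suc t))) (Vinv (\<lambda>i. \<phi> (s i)) l t (\<phi> (s (Suc t)))))"
  have D: "D > 0" unfolding D_def
    by (intro prod_pos ballI add_pos_nonneg inner_Vinv_nonneg[OF l]) auto
  have ld: "logdet \<phi> s l n = ln D" by (simp add: logdet_def det_gram_eq_prod[OF l] D_def)
  have "exp (inner S (Vinv (\<lambda>i. \<phi> (s i)) l n S) / 2) \<le> c * sqrt D"
    using le D by (simp add: self_normalized_def S_def D_def divide_le_eq)
  hence "ln (exp (inner S (Vinv (\<lambda>i. \<phi> (s i)) l n S) / 2)) \<le> ln (c * sqrt D)"
    using c D by (subst ln_le_cancel_iff) auto
  hence "inner S (Vinv (\<lambda>i. \<phi> (s i)) l n S) / 2 \<le> ln (c * sqrt D)" by simp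
  thus ?thesis using c D unfolding ld by (simp add: ln_mult_pos ln_sqrt)
qed

section \<open>Logarithmic inequalities and the sum of the exploration widths\<close>

lemma ln_one_plus_ge:
  fixes z :: real assumes "z \<ge> 0" shows "z / (1 + z) \<le> ln (1 + z)"
proof -
  have "ln (1 / (1 + z)) \<le> 1 / (1 + z) - 1" using assms by (intro ln_le_minus_one) simp
  moreover have "1 / (1 + z) - 1 = - (z / (1 + z))" using assms by (simp add: field_simps)
  ultimately show ?thesis using assms by (simp add: ln_div)
qed

text \<open>The clipped value is at most 1, so halving it is no larger than dividing by one plus it.
  The factor 2 here becomes the \<open>sqrt 2\<close> of the regret bound.\<close>

lemma min_one_le_ln:
  fixes y :: real assumes "y \<ge> 0" shows "min 1 y \<le> 2 * ln (1 + y)"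
proof -
  let ?z = "min 1 y"
  have "?z / 2 \<le> ?z / (1 + ?z)" using assms by (intro divide_left_mono) auto
  also have "\<dots> \<le> ln (1 + ?z)" using ln_one_plus_ge[of ?z] assms by simp
  also have "\<dots> \<le> ln (1 + y)" using assms by (subst ln_le_cancel_iff) auto
  finally show ?thesis by simp
qed

text \<open>As \<open>\<beta> \<ge> 1\<close>, the two bounds on \<open>\<Delta> t\<close> merge
  into \<open>2 * \<beta> * min 1 (w t)\<close>. Cauchy-Schwarz over the rounds then reduces the sum
  to squared clipped widths, which \<open>min_one_le_ln\<close> compares with logarithms.\<close>

lemma sum_clipped_widths:
  fixes \<Delta> w :: "nat \<Rightarrow> real"
  assumes \<Delta>: "\<And>t. t \<in> {1..T} \<Longrightarrow> \<Delta> t \<le> 2" "\<And>t. t \<in> {1..T} \<Longrightarrow> \<Delta> t \<le> 2 * \<beta> * w t"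
    and w: "\<And>t. t \<in> {1..T} \<Longrightarrow> w t \<ge> 0" and \<beta>: "\<beta> \<ge> 1"
    and D: "(\<Sum>t=1..T. ln (1 + (w t)\<^sup>2)) \<le> D"
  shows "(\<Sum>t=1..T. \<Delta> t) \<le> 2 * sqrt 2 * \<beta> * sqrt (real T * D)"
proof -
  have "(\<Sum>t=1..T. min 1 (w t))\<^sup>2 \<le> (\<Sum>t=1..T. (min 1 (w t))\<^sup>2) * (\<Sum>t=1..T. 1\<^sup>2)"
    using Cauchy_Schwarz_ineq_sum[of "\<lambda>t. min 1 (w t)" "\<lambda>_. 1" "{1..T}"] by simp
  also have "(\<Sum>t=1..T. (min 1 (w t))\<^sup>2) \<le> (\<Sum>t=1..T. 2 * ln (1 + (w t)\<^sup>2))"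
  proof (rule sum_mono)
    fix t assume "t \<in> {1..T}"
    hence "(min 1 (w t))\<^sup>2 = min 1 ((w t)\<^sup>2)"
      using w[of t] power_le_one[of "w t" 2] one_le_power[of "w t" 2]
      by (cases "w t \<le> 1") (simp_all add: min_absorb1 min_absorb2)
    thus "(min 1 (w t))\<^sup>2 \<le> 2 * ln (1 + (w t)\<^sup>2)" using min_one_le_ln[of "(w t)\<^sup>2"] by simp
  qed
  also have "\<dots> \<le> 2 * D" using D by (simp add: sum_distrib_left[symmetric])
  finally have "(\<Sum>t=1..T. min 1 (w t))\<^sup>2 \<le> 2 * (real T * D)"
    by (simp add: mult_right_mono mult_ac)
  hence S: "(\<Sum>t=1..T. min 1 (w t)) \<le> sqrt 2 * sqrt (real T * D)"
    using real_le_rsqrt real_sqrt_mult by metis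
  have "(\<Sum>t=1..T. \<Delta> t) \<le> (\<Sum>t=1..T. 2 * \<beta> * min 1 (w t))"
  proof (rule sum_mono)
    fix t assume t: "t \<in> {1..T}"
    show "\<Delta> t \<le> 2 * \<beta> * min 1 (w t)" using \<Delta>[OF t] \<beta> by (auto simp: min_def)
  qed
  also have "\<dots> = 2 * \<beta> * (\<Sum>t=1..T. min 1 (w t))" by (simp add: sum_distrib_left)
  also have "\<dots> \<le> 2 * \<beta> * (sqrt 2 * sqrt (real T * D))" using S \<beta> by (intro mult_left_mono) auto
  finally show ?thesis by (simp add: mult_ac)
qed

lemma logdet_mono:
  fixes \<phi> :: "'s \<Rightarrow> 'h::real_inner"
  assumes "l > 0" "m \<le> n" shows "logdet \<phi> s l m \<le> logdet \<phi> s l n"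
  unfolding logdet_eq_sum[OF assms(1)]
  by (intro sum_mono2 ln_ge_zero) (use assms(2) in \<open>auto simp: inner_Vinv_nonneg[OF assms(1)]\<close>)

lemma suboptimality_le_2:
  fixes \<phi> :: "'x \<times> 'a \<Rightarrow> 'h::real_inner"
  assumes "b \<in> A" "\<And>b. b \<in> A \<Longrightarrow> \<bar>inner (\<phi> (z, b)) \<theta>s\<bar> \<le> 1"
  shows "(SUP b\<in>A. inner (\<phi> (z, b)) \<theta>s) - inner (\<phi> (z, b)) \<theta>s \<le> 2"
proof -
  have "(SUP b\<in>A. inner (\<phi> (z, b)) \<theta>s) \<le> 1"
    by (rule cSUP_least) (use assms in \<open>auto simp: abs_le_iff\<close>)
  thus ?thesis using assms(2)[OF assms(1)] by linarith
qed

text \<open>Deterministic statement for a single outcome: probability enters only through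
  \<open>good\<close>. Indices \<open>n < T\<close> suffice, since round \<open>t\<close> relies on
  the first \<open>t - 1\<close> observations.\<close>

lemma kucb_regret_bound:
  fixes \<phi> :: "'x \<times> 'a \<Rightarrow> 'h::real_inner" and x :: "nat \<Rightarrow> 'x" and a :: "nat \<Rightarrow> 'a" and \<kappa> l :: real and T :: nat
  assumes kappa: "\<And>s. kern \<phi> s s \<le> \<kappa>\<^sup>2"
    and T2: "T \<ge> 2" and l: "l > 0" and B: "norm \<theta>s \<le> B"
    and bounded: "\<And>t z b. t \<ge> 1 \<Longrightarrow> b \<in> A t \<Longrightarrow> \<bar>inner (\<phi> (z, b)) \<theta>s\<bar> \<le> 1"
    and rule: "kucb_rule \<phi> A x a (\<lambda>t. inner \<theta>s (\<phi> (x t, a t)) + e t) l B (1 / (real T)\<^sup>2) T"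
    and good: "\<And>n. n < T \<Longrightarrow> self_normalized (\<lambda>i. \<phi> (x i, a i)) e l n \<le> (real T)\<^sup>2"
  defines "C \<equiv> ln (exp 1 + exp 1 * real T * \<kappa>\<^sup>2 / l) * d_eff \<phi> (\<lambda>t. (x t, a t)) l T"
  shows "(\<Sum>t=1..T. (SUP b\<in>A t. inner (\<phi> (x t, b)) \<theta>s) - inner (\<phi> (x t, a t)) \<theta>s)
    \<le> 2 * sqrt 2 * (sqrt l * B + sqrt (4 * ln (real T) + C)) * sqrt (real T * C)"
proof -
  define s f where "s t = (x t, a t)" and "f t = \<phi> (s t)" for t
  define \<beta> where "\<beta> = sqrt l * B + sqrt (4 * ln (real T) + C)"
  define w where "w t = sqrt (inner (f t) (Vinv f l (t - 1) (f t)))" for t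
  have LC: "logdet \<phi> s l T \<le> C" unfolding C_def s_def[abs_def] by (rule d_eff_bounds(3)[OF kappa l])
  have C0: "C \<ge> 0" using LC logdet_mono[OF l, of 0 T \<phi> s] by (simp add: logdet_def det_dim_zero gram_def)
  have B0: "B \<ge> 0" using B norm_ge_zero order.trans by blast
  \<comment> \<open>This yields \<open>\<beta> \<ge> 1\<close>, which the clipping argument
    requires.\<close>
  have ln2: "4 * ln (real T) \<ge> 1"
  proof -
    have "1/2 \<le> ln (2::real)" using ln_one_plus_ge[of 1] by simp
    also have "ln 2 \<le> ln (real T)" using T2 by (subst ln_le_cancel_iff) auto
    finally show ?thesis by simp
  qed
  show ?thesis unfolding \<beta>_def[symmetric]
  proof (rule sum_clipped_widths[where w = w])
    have "1 \<le> sqrt (4 * ln (real T) + C)" using ln2 C0 by simp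
    thus "\<beta> \<ge> 1" using l B0 by (simp add: \<beta>_def add_increasing)
    show "w t \<ge> 0" for t by (simp add: w_def inner_Vinv_nonneg[OF l])
    have "(\<Sum>t=1..T. ln (1 + (w t)\<^sup>2)) = logdet \<phi> s l T"
      unfolding logdet_eq_sum[OF l]
      by (simp add: sum.atLeast1_atMost_eq w_def inner_Vinv_nonneg[OF l] f_def[abs_def])
    thus "(\<Sum>t=1..T. ln (1 + (w t)\<^sup>2)) \<le> C" using LC by simp
    fix t assume t: "t \<in> {1..T}"
    have at: "a t \<in> A t" and opt: "\<And>b. b \<in> A t \<Longrightarrow>
       ucb \<phi> x a (\<lambda>t. inner \<theta>s (\<phi> (x t, a t)) + e t) l B (1 / (real T)\<^sup>2) t b
         \<le> ucb \<phi> x a (\<lambda>t. inner \<theta>s (\<phi> (x t, a t)) + e t) l B (1 / (real T)\<^sup>2) t (a t)"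
      using rule t unfolding kucb_rule_def by blast+
    show "(SUP b\<in>A t. inner (\<phi> (x t, b)) \<theta>s) - inner (\<phi> (x t, a t)) \<theta>s \<le> 2"
      by (rule suboptimality_le_2[OF at]) (use bounded t in auto)
    define \<theta>h where "\<theta>h = theta_hat f (\<lambda>i. inner \<theta>s (f i) + e i) l (t - 1)"
    define bt where "bt = beta \<phi> s l B (1 / (real T)\<^sup>2) t"
    define V where "V = Vnorm (inv_into UNIV (Vop f l (t - 1)))"
    have V0: "V u \<ge> 0" for u by (simp add: V_def Vnorm_def inv_Vop[OF l] inner_Vinv_nonneg[OF l])
    have ucb: "ucb \<phi> x a (\<lambda>t. inner \<theta>s (\<phi> (x t, a t)) + e t) l B (1 / (real T)\<^sup>2) t b
       = inner \<theta>h (\<phi> (x t, b)) + bt * V (\<phi> (x t, b))" for b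
      by (simp add: ucb_def Let_def \<theta>h_def bt_def V_def f_def[abs_def] s_def[abs_def])
    \<comment> \<open>For the confidence level \<open>1 / T^2\<close>, the term
      \<open>2 * ln (1 / \<delta>)\<close> is \<open>4 * ln (real T)\<close>.\<close>
    have bt: "bt = sqrt l * B + sqrt (4 * ln (real T) + logdet \<phi> s l (t - 1))"
      using T2 by (simp add: bt_def beta_def ln_realpow)
    have "bt \<le> \<beta>" unfolding bt \<beta>_def
      using LC logdet_mono[OF l, of "t - 1" T \<phi> s] t by fastforce
    have err: "\<bar>inner \<theta>h u - inner \<theta>s u\<bar> \<le> bt * V u" for u
    proof -
      let ?S = "noise_sum f e (t - 1)"
      have "self_normalized (\<lambda>i. \<phi> (s i)) e l (t - 1) \<le> (real T)\<^sup>2"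
        using good[of "t - 1"] t by (auto simp: s_def[abs_def])
      hence "inner ?S (Vinv f l (t - 1) ?S) \<le> 2 * ln ((real T)\<^sup>2) + logdet \<phi> s l (t - 1)"
        using self_normalized_le_imp[OF l, of "(real T)\<^sup>2" \<phi> s e "t - 1"] T2 by (simp add: f_def[abs_def])
      hence "sqrt l * B + sqrt (inner ?S (Vinv f l (t - 1) ?S)) \<le> bt"
        unfolding bt using T2 by (simp add: ln_realpow)
      hence "(sqrt l * B + sqrt (inner ?S (Vinv f l (t - 1) ?S))) * V u \<le> bt * V u"
        using V0 by (rule mult_right_mono)
      thus ?thesis using theta_hat_error[OF l B, of f e "t - 1" u] by (simp add: \<theta>h_def V_def)
    qed
    \<comment> \<open>Optimism: the true value of \<open>b\<close> is at most its index, hence at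
      most the index of \<open>a t\<close>, which exceeds the true value of \<open>a t\<close> by at
      most twice the confidence width.\<close>
    have "(SUP b\<in>A t. inner (\<phi> (x t, b)) \<theta>s) \<le> inner (\<phi> (x t, a t)) \<theta>s + 2 * (bt * V (\<phi> (x t, a t)))"
    proof (rule cSUP_least)
      fix b assume b: "b \<in> A t"
      show "inner (\<phi> (x t, b)) \<theta>s \<le> inner (\<phi> (x t, a t)) \<theta>s + 2 * (bt * V (\<phi> (x t, a t)))"
        using opt[OF b] err[of "\<phi> (x t, b)"] err[of "\<phi> (x t, a t)"]
        unfolding ucb abs_le_iff inner_commute[of _ \<theta>s] by linarith
    qed (use at in auto)
    moreover have "V (\<phi> (x t, a t)) = w t"
      by (simp add: V_def Vnorm_def inv_Vop[OF l] w_def f_def s_def)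
    moreover have "bt * w t \<le> \<beta> * w t"
      using \<open>bt \<le> \<beta>\<close> by (rule mult_right_mono) (simp add: w_def inner_Vinv_nonneg[OF l])
    ultimately show "(SUP b\<in>A t. inner (\<phi> (x t, b)) \<theta>s) - inner (\<phi> (x t, a t)) \<theta>s \<le> 2 * \<beta> * w t"
      by simp
  qed
qed

section \<open>Measurability and moment bounds for the passage to probabilities and
  expectations\<close>

lemma borel_measurable_det:
  fixes K :: "'w \<Rightarrow> real mat"
  assumes "\<And>\<omega>. K \<omega> \<in> carrier_mat n n"
    and "\<And>i j. i < n \<Longrightarrow> j < n \<Longrightarrow> (\<lambda>\<omega>. K \<omega> $$ (i, j)) \<in> borel_measurable M"
  shows "(\<lambda>\<omega>. Determinant.det (K \<omega>)) \<in> borel_measurable M"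
  unfolding det_def'[OF assms(1)]
proof (intro borel_measurable_sum borel_measurable_times borel_measurable_prod borel_measurable_const assms(2))
  fix p i assume "p \<in> {p. p permutes {0..<n}}" "i \<in> {0..<n}"
  thus "i < n" "p i < n" using permutes_in_image[of p "{0..<n}" i] by simp_all
qed

text \<open>The adjugate formula makes \<open>d_eff\<close> a quotient of polynomials in kernel
  values, and the spectrum shows that the denominator never vanishes.\<close>

lemma borel_measurable_d_eff:
  fixes \<phi> :: "'s \<Rightarrow> 'h::real_inner" and s :: "'w \<Rightarrow> nat \<Rightarrow> 's"
  assumes kappa: "\<And>s. kern \<phi> s s \<le> \<kappa>\<^sup>2" and l: "l > 0"
    and meas: "\<And>i j. i \<in> {1..n} \<Longrightarrow> j \<in> {1..n} \<Longrightarrow> (\<lambda>\<omega>. inner (\<phi> (s \<omega> i)) (\<phi> (s \<omega> j))) \<in> borel_measurable M"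
  shows "(\<lambda>\<omega>. d_eff \<phi> (s \<omega>) l n) \<in> borel_measurable M"
proof -
  define A where "A \<omega> = gram \<phi> (s \<omega>) n + l \<cdot>\<^sub>m 1\<^sub>m n" for \<omega>
  have cA: "A \<omega> \<in> carrier_mat n n" for \<omega> by (simp add: A_def gram_def)
  have entry: "(\<lambda>\<omega>. A \<omega> $$ (i, j)) \<in> borel_measurable M" if "i < n" "j < n" for i j
    using that meas[of "Suc i" "Suc j"] by (simp add: A_def gram_def kern_def)
  have det: "(\<lambda>\<omega>. Determinant.det (A \<omega>)) \<in> borel_measurable M"
    by (rule borel_measurable_det[OF cA entry])
  have minor: "(\<lambda>\<omega>. Determinant.det (mat_delete (A \<omega>) i i)) \<in> borel_measurable M" if "i < n" for i
  proof (rule borel_measurable_det)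
    show "mat_delete (A \<omega>) i i \<in> carrier_mat (n - 1) (n - 1)" for \<omega> by (rule mat_delete_carrier[OF cA])
    show "(\<lambda>\<omega>. mat_delete (A \<omega>) i i $$ (j, k)) \<in> borel_measurable M" if "j < n - 1" "k < n - 1" for j k
      using that cA by (simp add: mat_delete_def carrier_matD[OF cA] entry)
  qed
  have "Determinant.det (A \<omega>) \<noteq> 0" for \<omega>
  proof -
    obtain ms where "set ms \<subseteq> {0..real n * \<kappa>\<^sup>2}" "Determinant.det (A \<omega>) = (\<Prod>m\<leftarrow>ms. l + m)"
      using gram_spectrum[OF kappa l, of n "s \<omega>"] unfolding A_def by metis
    thus ?thesis using l by (fastforce simp: prod_list_zero_iff)
  qed
  hence "d_eff \<phi> (s \<omega>) l n = real n - l * ((\<Sum>i<n. Determinant.det (mat_delete (A \<omega>) i i)) / Determinant.det (A \<omega>))" for \<omega>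
    using d_eff_eq_trace_adj[of \<phi> "s \<omega>" n l] cA[of \<omega>]
    by (simp add: A_def[symmetric] mat_trace_def adj_mat_def cofactor_def flip: mult_2)
  thus ?thesis using det minor by simp
qed

text \<open>The conditional bound is integrated against the constant weight 1.\<close>

lemma subgaussian_mgf:
  fixes e :: "'w \<Rightarrow> real"
  assumes P: "prob_space M" and sub: "subalgebra M G" and e[measurable]: "e \<in> borel_measurable M"
    and subgauss: "AE \<omega> in M. nn_cond_exp M G (\<lambda>\<omega>. ennreal (exp (\<nu> * e \<omega>))) \<omega> \<le> ennreal (exp (\<nu>\<^sup>2 / 2))"
  shows "(\<integral>\<^sup>+\<omega>. ennreal (exp (\<nu> * e \<omega>)) \<partial>M) \<le> ennreal (exp (\<nu>\<^sup>2 / 2))"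
proof -
  interpret prob_space M by fact
  interpret finite_measure_subalgebra M G by (unfold_locales) (rule sub)
  have "(\<integral>\<^sup>+\<omega>. ennreal (exp (\<nu> * e \<omega>)) \<partial>M) = (\<integral>\<^sup>+\<omega>. 1 * ennreal (exp (\<nu> * e \<omega>)) \<partial>M)" by simp
  also have "\<dots> = (\<integral>\<^sup>+\<omega>. 1 * nn_cond_exp M G (\<lambda>\<omega>. ennreal (exp (\<nu> * e \<omega>))) \<omega> \<partial>M)"
    by (rule nn_cond_exp_intg[symmetric]) measurable
  also have "\<dots> \<le> (\<integral>\<^sup>+\<omega>. ennreal (exp (\<nu>\<^sup>2 / 2)) \<partial>M)"
    using subgauss by (intro nn_integral_mono_AE) simp
  also have "\<dots> = ennreal (exp (\<nu>\<^sup>2 / 2))" by (simp add: emeasure_space_1)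
  finally show ?thesis .
qed

lemma (in prob_space) markov_le_one:
  assumes Z[measurable]: "Z \<in> borel_measurable M" and Z1: "(\<integral>\<^sup>+\<omega>. ennreal (Z \<omega>) \<partial>M) \<le> 1" and c: "c > 0"
  shows "prob {\<omega>\<in>space M. c < Z \<omega>} \<le> 1 / c"
proof -
  have "emeasure M {\<omega>\<in>space M. c < Z \<omega>} \<le> emeasure M ({\<omega>\<in>space M. 1 \<le> ennreal (1 / c) * ennreal (Z \<omega>)})"
  proof (rule emeasure_mono)
    show "{\<omega>\<in>space M. c < Z \<omega>} \<subseteq> {\<omega>\<in>space M. 1 \<le> ennreal (1 / c) * ennreal (Z \<omega>)}"
    proof clarify
      fix \<omega> assume Z: "c < Z \<omega>"
      have "1 = ennreal 1" by simp
      also have "\<dots> \<le> ennreal (1 / c * Z \<omega>)" using c Z by (intro ennreal_leI) simp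
      also have "\<dots> = ennreal (1 / c) * ennreal (Z \<omega>)" using c Z by (intro ennreal_mult) auto
      finally show "1 \<le> ennreal (1 / c) * ennreal (Z \<omega>)" .
    qed
  qed measurable
  also have "\<dots> \<le> ennreal (1 / c) * (\<integral>\<^sup>+\<omega>. ennreal (Z \<omega>) * indicator (space M) \<omega> \<partial>M)"
    using nn_integral_Markov_inequality[where u = "\<lambda>\<omega>. ennreal (Z \<omega>)" and M = M and A = "space M" and c = "ennreal (1 / c)"]
    by simp
  also have "(\<integral>\<^sup>+\<omega>. ennreal (Z \<omega>) * indicator (space M) \<omega> \<partial>M) = (\<integral>\<^sup>+\<omega>. ennreal (Z \<omega>) \<partial>M)"
    by (rule nn_integral_cong) simp
  also have "ennreal (1 / c) * \<dots> \<le> ennreal (1 / c) * 1" by (rule mult_left_mono[OF Z1]) simp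
  finally show ?thesis using c by (simp add: emeasure_eq_measure)
qed

theorem theorem1:
  fixes M :: "'w measure" and F :: "nat \<Rightarrow> 'w measure"
    and MX :: "'x measure" and MA :: "'a measure"
    and \<phi> :: "'x \<times> 'a \<Rightarrow> 'h::{real_inner, complete_space}"
    and A :: "nat \<Rightarrow> 'a set"
    and x :: "nat \<Rightarrow> 'w \<Rightarrow> 'x" and a :: "nat \<Rightarrow> 'w \<Rightarrow> 'a" and \<epsilon> :: "nat \<Rightarrow> 'w \<Rightarrow> real"
    and \<theta>s :: 'h and \<kappa> lam B :: real and T :: nat
  assumes P: "prob_space M"
    and filt: "\<And>n. subalgebra M (F n)" "\<And>m n. m \<le> n \<Longrightarrow> subalgebra (F n) (F m)"
    and x_meas: "\<And>t. t \<ge> 1 \<Longrightarrow> x t \<in> measurable (F (t - 1)) MX"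
    and a_meas: "\<And>t. t \<ge> 1 \<Longrightarrow> a t \<in> measurable (F (t - 1)) MA"
    and phi_meas: "\<And>h. (\<lambda>s. inner h (\<phi> s)) \<in> borel_measurable (MX \<Otimes>\<^sub>M MA)"
    and kern_meas: "(\<lambda>(s, s'). kern \<phi> s s') \<in> borel_measurable ((MX \<Otimes>\<^sub>M MA) \<Otimes>\<^sub>M (MX \<Otimes>\<^sub>M MA))"
    and eps_meas: "\<And>t. t \<ge> 1 \<Longrightarrow> \<epsilon> t \<in> borel_measurable (F t)"
    and subgauss: "\<And>t \<nu>. t \<ge> 1 \<Longrightarrow> \<nu> \<in> borel_measurable (F (t - 1)) \<Longrightarrow>
        AE \<omega> in M. nn_cond_exp M (F (t - 1)) (\<lambda>\<omega>. ennreal (exp (\<nu> \<omega> * \<epsilon> t \<omega>))) \<omega>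
                     \<le> ennreal (exp ((\<nu> \<omega>)\<^sup>2 / 2))"
    and kappa: "\<And>s. kern \<phi> s s \<le> \<kappa>\<^sup>2"
    and T2: "T \<ge> 2" and lam_pos: "lam > 0" and B: "B \<ge> norm \<theta>s"
    and bounded: "\<And>t z b. t \<ge> 1 \<Longrightarrow> b \<in> A t \<Longrightarrow> \<bar>inner (\<phi> (z, b)) \<theta>s\<bar> \<le> 1"
    and rule: "\<And>\<omega>. \<omega> \<in> space M \<Longrightarrow>
        kucb_rule \<phi> A (\<lambda>t. x t \<omega>) (\<lambda>t. a t \<omega>)
          (\<lambda>t. inner \<theta>s (\<phi> (x t \<omega>, a t \<omega>)) + \<epsilon> t \<omega>) lam B (1 / (real T)\<^sup>2) T"
  shows
    "let L = ln (exp 1 + exp 1 * real T * \<kappa>\<^sup>2 / lam);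
         deff = (\<lambda>\<omega>. d_eff \<phi> (\<lambda>t. (x t \<omega>, a t \<omega>)) lam T);
         \<beta>bar = (\<lambda>\<omega>. sqrt lam * B + sqrt (4 * ln (real T) + L * deff \<omega>));
         \<Delta> = (\<lambda>t \<omega>. (SUP b\<in>A t. inner (\<phi> (x t \<omega>, b)) \<theta>s) - inner (\<phi> (x t \<omega>, a t \<omega>)) \<theta>s);
         r = (\<lambda>t \<omega>. inner \<theta>s (\<phi> (x t \<omega>, a t \<omega>)) + \<epsilon> t \<omega>)
     in (\<exists>E\<in>sets M. measure M E \<ge> 1 - 1 / real T \<and>
           (\<forall>\<omega>\<in>E. (\<Sum>t=1..T. \<Delta> t \<omega>) \<le> 2 * sqrt 2 * \<beta>bar \<omega> * sqrt (real T * L * deff \<omega>)))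
      \<and> (\<integral>\<omega>. (\<Sum>t=1..T. (SUP b\<in>A t. inner \<theta>s (\<phi> (x t \<omega>, b))) - r t \<omega>) \<partial>M)
          \<le> 2 + 2 * sqrt 2 * (\<integral>\<omega>. \<beta>bar \<omega> * sqrt (real T * L * deff \<omega>) \<partial>M)"
proof -
  interpret prob_space M by fact
  define L where "L = ln (exp 1 + exp 1 * real T * \<kappa>\<^sup>2 / lam)"
  define deff where "deff \<omega> = d_eff \<phi> (\<lambda>t. (x t \<omega>, a t \<omega>)) lam T" for \<omega>
  define G where "G \<omega> = (sqrt lam * B + sqrt (4 * ln (real T) + L * deff \<omega>)) * sqrt (real T * L * deff \<omega>)" for \<omega>
  define \<Delta> where "\<Delta> t \<omega> = (SUP b\<in>A t. inner (\<phi> (x t \<omega>, b)) \<theta>s) - inner (\<phi> (x t \<omega>, a t \<omega>)) \<theta>s" for t \<omega>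
  define sn where "sn n \<omega> = self_normalized (\<lambda>i. \<phi> (x i \<omega>, a i \<omega>)) (\<lambda>i. \<epsilon> i \<omega>) lam n" for n \<omega>
  have T0: "real T > 0" using T2 by simp
  have B0: "B \<ge> 0" using B norm_ge_zero order.trans by blast
  have pair: "(\<lambda>\<omega>. (x i \<omega>, a i \<omega>)) \<in> measurable (F n) (MX \<Otimes>\<^sub>M MA)" if "i \<in> {1..Suc n}" for i n
    using that measurable_from_subalg[OF filt(2)[of "i - 1" n] x_meas]
      measurable_from_subalg[OF filt(2)[of "i - 1" n] a_meas] by (intro measurable_Pair) auto
  \<comment> \<open>Joint measurability of the kernel gives the Gram entries as real random
    variables, including those of the upcoming round \<open>Suc n\<close>.\<close>
  have gram: "(\<lambda>\<omega>. inner (\<phi> (x i \<omega>, a i \<omega>)) (\<phi> (x j \<omega>, a j \<omega>))) \<in> borel_measurable (F n)"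
    if "i \<in> {1..Suc n}" "j \<in> {1..Suc n}" for i j n
    using measurable_compose[OF measurable_Pair[OF pair[OF that(1)] pair[OF that(2)]] kern_meas]
    by (simp add: kern_def)
  have "sn n \<in> borel_measurable (F n) \<and> (\<integral>\<^sup>+\<omega>. ennreal (sn n \<omega>) \<partial>M) \<le> 1" for n
    unfolding sn_def[abs_def]
    by (rule nn_integral_self_normalized[where M = M and F = F and \<epsilon> = \<epsilon> and l = lam
          and f = "\<lambda>i \<omega>. \<phi> (x i \<omega>, a i \<omega>)"])
       (fact P filt gram eps_meas subgauss lam_pos)+
  hence SN: "sn n \<in> borel_measurable (F n)" "(\<integral>\<^sup>+\<omega>. ennreal (sn n \<omega>) \<partial>M) \<le> 1" for n
    by blast+
  have [measurable]: "sn n \<in> borel_measurable M" for n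
    using measurable_from_subalg[OF filt(1) SN(1)] .
  \<comment> \<open>The threshold is \<open>1 / \<delta>\<close>, so each of the \<open>T\<close>
    bad events has probability at most \<open>1 / T^2\<close> and their union at most
    \<open>1 / T\<close>.\<close>
  define bad where "bad n = {\<omega>\<in>space M. (real T)\<^sup>2 < sn n \<omega>}" for n
  have bad_sets: "bad n \<in> sets M" for n unfolding bad_def by measurable
  define E where "E = space M - (\<Union>n<T. bad n)"
  have E: "E \<in> sets M" unfolding E_def using bad_sets by auto
  have "prob (\<Union>n<T. bad n) \<le> (\<Sum>n<T. prob (bad n))"
    by (rule finite_measure_subadditive_finite) (use bad_sets in auto)
  also have "\<dots> \<le> (\<Sum>n<T. 1 / (real T)\<^sup>2)"
    unfolding bad_def using T0 by (intro sum_mono markov_le_one SN(2)) auto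
  also have "\<dots> = 1 / real T" using T0 by (simp add: power2_eq_square)
  finally have PE: "prob (space M - E) \<le> 1 / real T"
    using bad_sets sets.sets_into_space[OF bad_sets] by (simp add: E_def double_diff UN_least)
  hence PE': "prob E \<ge> 1 - 1 / real T" using prob_compl[OF E] by simp
  have main: "(\<Sum>t=1..T. \<Delta> t \<omega>) \<le> 2 * sqrt 2 * G \<omega>" if "\<omega> \<in> E" for \<omega>
  proof -
    have good: "sn n \<omega> \<le> (real T)\<^sup>2" if "n < T" for n
      using \<open>\<omega> \<in> E\<close> that by (auto simp: E_def bad_def not_less)
    have "\<omega> \<in> space M" using that by (simp add: E_def)
    from kucb_regret_bound[OF kappa T2 lam_pos B bounded rule[OF this] good[unfolded sn_def]]
    show ?thesis by (simp add: \<Delta>_def G_def L_def deff_def mult.assoc)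
  qed
  have L0: "L \<ge> 0"
    unfolding L_def using lam_pos exp_ge_add_one_self[of 1]
    by (intro ln_ge_zero add_increasing2 divide_nonneg_nonneg) auto
  have deff: "0 \<le> deff \<omega>" "deff \<omega> \<le> real T" for \<omega>
    unfolding deff_def by (rule d_eff_bounds[OF kappa lam_pos])+
  have [measurable]: "deff \<in> borel_measurable M"
    unfolding deff_def[abs_def]
  proof (rule borel_measurable_d_eff[OF kappa lam_pos])
    fix i j assume "i \<in> {1..T}" "j \<in> {1..T}"
    thus "(\<lambda>\<omega>. inner (\<phi> (x i \<omega>, a i \<omega>)) (\<phi> (x j \<omega>, a j \<omega>))) \<in> borel_measurable M"
      by (intro measurable_from_subalg[OF filt(1)[of T]] gram) auto
  qed
  have [measurable]: "G \<in> borel_measurable M" unfolding G_def[abs_def] by measurable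
  have lnT: "ln (real T) \<ge> 0" using T2 by simp
  have G0: "G \<omega> \<ge> 0" for \<omega>
    unfolding G_def using lam_pos B0 L0 deff lnT
    by (intro mult_nonneg_nonneg add_nonneg_nonneg real_sqrt_ge_zero) auto
  \<comment> \<open>Since \<open>deff\<close> is at most \<open>T\<close>, \<open>G\<close> is
    bounded by a constant and hence integrable.\<close>
  have "G \<omega> \<le> (sqrt lam * B + sqrt (4 * ln (real T) + L * real T)) * sqrt (real T * L * real T)" for \<omega>
    unfolding G_def using lam_pos B0 L0 deff[of \<omega>] lnT
    by (intro mult_mono add_mono real_sqrt_le_mono mult_left_mono order.refl add_nonneg_nonneg
        mult_nonneg_nonneg real_sqrt_ge_zero) auto
  hence iG: "integrable M G" using G0 by (intro integrable_const_bound) auto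
  have \<Delta>2: "\<Delta> t \<omega> \<le> 2" if "t \<in> {1..T}" "\<omega> \<in> space M" for t \<omega>
    unfolding \<Delta>_def using rule[OF that(2)] that(1) bounded
    by (intro suboptimality_le_2) (auto simp: kucb_rule_def)
  have eps: "integrable M (\<epsilon> t)" "(\<integral>\<omega>. \<epsilon> t \<omega> \<partial>M) = 0" if "t \<in> {1..T}" for t
  proof -
    have e: "\<epsilon> t \<in> borel_measurable M" using measurable_from_subalg[OF filt(1) eps_meas] that by simp
    have "(\<integral>\<^sup>+\<omega>. ennreal (exp (\<nu> * \<epsilon> t \<omega>)) \<partial>M) \<le> ennreal (exp (\<nu>\<^sup>2 / 2))" for \<nu>
      by (rule subgaussian_mgf[OF P filt(1)[of "t - 1"] e])
         (use subgauss[of t "\<lambda>_. \<nu>"] that in simp)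
    thus "integrable M (\<epsilon> t)" "(\<integral>\<omega>. \<epsilon> t \<omega> \<partial>M) = 0"
      using subgaussian_centered[OF P e] by blast+
  qed
  define H where "H \<omega> = (\<Sum>t=1..T. (SUP b\<in>A t. inner \<theta>s (\<phi> (x t \<omega>, b)))
      - (inner \<theta>s (\<phi> (x t \<omega>, a t \<omega>)) + \<epsilon> t \<omega>))" for \<omega>
  \<comment> \<open>\<open>H\<close> is the realised regret; it differs from the sum of gaps only by
    noise of mean zero.\<close>
  have H: "(\<Sum>t=1..T. \<Delta> t \<omega>) = H \<omega> + (\<Sum>t=1..T. \<epsilon> t \<omega>)" for \<omega>
    by (simp add: H_def \<Delta>_def inner_commute[of _ \<theta>s] sum.distrib[symmetric])
  have regret: "(\<integral>\<omega>. H \<omega> \<partial>M) \<le> 2 + 2 * sqrt 2 * (\<integral>\<omega>. G \<omega> \<partial>M)"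
  proof (cases "integrable M H")
    case False
    \<comment> \<open>The suprema over \<open>A t\<close> need not be measurable; the Bochner integral is then 0.\<close>
    have "0 \<le> (\<integral>\<omega>. G \<omega> \<partial>M)" using G0 by simp
    thus ?thesis using False by (simp add: not_integrable_integral_eq)
  next
    case True
    have ie: "integrable M (\<lambda>\<omega>. \<Sum>t=1..T. \<epsilon> t \<omega>)" by (intro Bochner_Integration.integrable_sum eps)
    have int\<Delta>: "integrable M (\<lambda>\<omega>. \<Sum>t=1..T. \<Delta> t \<omega>)"
      unfolding H by (intro Bochner_Integration.integrable_add True ie)
    have "(\<integral>\<omega>. (\<Sum>t=1..T. \<Delta> t \<omega>) \<partial>M) = (\<integral>\<omega>. H \<omega> \<partial>M) + (\<integral>\<omega>. (\<Sum>t=1..T. \<epsilon> t \<omega>) \<partial>M)"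
      unfolding H by (rule Bochner_Integration.integral_add[OF True ie])
    also have "(\<integral>\<omega>. (\<Sum>t=1..T. \<epsilon> t \<omega>) \<partial>M) = 0"
      by (subst Bochner_Integration.integral_sum) (use eps in auto)
    finally have "(\<integral>\<omega>. H \<omega> \<partial>M) = (\<integral>\<omega>. (\<Sum>t=1..T. \<Delta> t \<omega>) \<partial>M)" by simp
    \<comment> \<open>Outside \<open>E\<close> each round costs at most 2; this event has
      probability at most \<open>1 / T\<close>, so it contributes the additive 2.\<close>
    also have "\<dots> \<le> (\<integral>\<omega>. 2 * sqrt 2 * G \<omega> + 2 * real T * indicator (space M - E) \<omega> \<partial>M)"
    proof (rule integral_mono[OF int\<Delta>])
      show "integrable M (\<lambda>\<omega>. 2 * sqrt 2 * G \<omega> + 2 * real T * indicator (space M - E) \<omega>)"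
        using E iG by (intro Bochner_Integration.integrable_add integrable_mult_right)
          (auto simp: integrable_indicator_iff emeasure_eq_measure)
      fix \<omega> assume \<omega>: "\<omega> \<in> space M"
      show "(\<Sum>t=1..T. \<Delta> t \<omega>) \<le> 2 * sqrt 2 * G \<omega> + 2 * real T * indicator (space M - E) \<omega>"
      proof (cases "\<omega> \<in> E")
        case True
        thus ?thesis using main by simp
      next
        case False
        have "(\<Sum>t=1..T. \<Delta> t \<omega>) \<le> (\<Sum>t=1..T. 2)" by (rule sum_mono) (use \<Delta>2 \<omega> in auto)
        also have "\<dots> = 2 * real T" by simp
        finally have "(\<Sum>t=1..T. \<Delta> t \<omega>) \<le> 2 * real T" .
        moreover have "0 \<le> 2 * sqrt 2 * G \<omega>" using G0 by simp
        moreover have "2 * real T * indicator (space M - E) \<omega> = 2 * real T" using False \<omega> by simp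
        ultimately show ?thesis by linarith
      qed
    qed
    also have "\<dots> = 2 * sqrt 2 * (\<integral>\<omega>. G \<omega> \<partial>M) + 2 * real T * prob (space M - E)"
      using E iG by (subst Bochner_Integration.integral_add)
        (auto simp: integrable_indicator_iff emeasure_eq_measure Int_absorb2)
    also have "2 * real T * prob (space M - E) \<le> 2 * real T * (1 / real T)"
      using PE T0 by (intro mult_left_mono) auto
    finally show ?thesis using T0 by simp
  qed
  show ?thesis
    unfolding Let_def
  proof (intro conjI bexI[of _ E] ballI)
    show "1 - 1 / real T \<le> prob E" by (rule PE')
    show "E \<in> events" by (rule E)
  next
    fix \<omega> assume "\<omega> \<in> E"
    from main[OF this] show "(\<Sum>t=1..T. (SUP b\<in>A t. inner (\<phi> (x t \<omega>, b)) \<theta>s) - inner (\<phi> (x t \<omega>, a t \<omega>)) \<theta>s)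
      \<le> 2 * sqrt 2 * (sqrt lam * B + sqrt (4 * ln (real T) + ln (exp 1 + exp 1 * real T * \<kappa>\<^sup>2 / lam) *
            d_eff \<phi> (\<lambda>t. (x t \<omega>, a t \<omega>)) lam T)) *
          sqrt (real T * ln (exp 1 + exp 1 * real T * \<kappa>\<^sup>2 / lam) * d_eff \<phi> (\<lambda>t. (x t \<omega>, a t \<omega>)) lam T)"
      unfolding \<Delta>_def G_def L_def deff_def by (simp only: mult.assoc)
  qed (rule regret[unfolded H_def G_def L_def deff_def])
qed

end
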